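(* Let $Q$ be a redoublable Coxeter polyhedron in $H^n$, let $W=W(Q)$ be its Coxeter group, and let $I$ be any positive integer. Then $W$ has a subgroup of index $I$ which is generated by reflections.
   Context: A Coxeter polyhedron in hyperbolic space $H^n$ is a convex polyhedron (with nonempty interior) all of whose dihedral angles are of the form $\pi/m$ with $m\ge2$ an integer. A wall of a polyhedron is a codimension one face; two walls meet if they have nonempty intersection in $H^n$. $W(Q)$ denotes the group of isometries of $H^n$ generated by the reflections across the walls of $Q$. A wall of a Coxeter polyhedron is a doubling wall if the angles it makes with the walls it meets are all even submultiples of $\pi$ (of the form $\pi/m$ with $m$ even). A polyhedron is redoublable if it is a Coxeter polyhedron with two doubling walls that do not meet each other in $H^n$. "Reflections" means reflections of $H^n$ across hyperplanes. *)

theory Defs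
  imports "HOL-Analysis.Analysis" "HOL-Algebra.Elementary_Groups"
begin

section \<open>Hyperbolic space\<close>

text \<open>
  The hyperboloid model.  For a Euclidean space of dimension \<open>n\<close>, the product with the
  real line is Minkowski space with the form below, of signature \<open>(n,1)\<close>, and \<open>H\<^sup>n\<close> is
  the upper sheet of the set of vectors of norm \<open>-1\<close>.
\<close>

definition lor :: "'a::euclidean_space \<times> real \<Rightarrow> 'a \<times> real \<Rightarrow> real" where
  "lor u v = fst u \<bullet> fst v - snd u * snd v"

lemma lor_commute: "lor u v = lor v u"
  by (simp add: lor_def inner_commute)

lemma lor_algebra:
  "lor (u + v) w = lor u w + lor v w" "lor w (u + v) = lor w u + lor w v"
  "lor (u - v) w = lor u w - lor v w" "lor w (u - v) = lor w u - lor w v"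
  "lor (c *\<^sub>R u) w = c * lor u w" "lor w (c *\<^sub>R u) = c * lor w u"
  by (simp_all add: lor_def algebra_simps)

typedef (overloaded) ('a::euclidean_space) hyp =
  "{p :: 'a \<times> real. lor p p = -1 \<and> snd p > 0}"
  by (rule exI[of _ "(0, 1)"]) (simp add: lor_def)

lemma lor_Rep_hyp: "lor (Rep_hyp x) (Rep_hyp x) = -1"
  and snd_Rep_hyp: "snd (Rep_hyp x) > 0"
  using Rep_hyp[of x] by auto

lemma lor_timelike_orth:
  assumes y: "lor y y = -1" and u: "lor u y = 0"
  shows "lor u u \<ge> (snd u)\<^sup>2 / (snd y)\<^sup>2" "snd y \<noteq> 0"
proof -
  have yy: "(snd y)\<^sup>2 = 1 + fst y \<bullet> fst y"
    using y by (simp add: lor_def power2_eq_square)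
  then have pos: "(snd y)\<^sup>2 \<ge> 1" by simp
  then show "snd y \<noteq> 0" by auto
  have "fst u \<bullet> fst y = snd u * snd y" using u by (simp add: lor_def)
  then have "(snd u)\<^sup>2 * (snd y)\<^sup>2 \<le> (fst u \<bullet> fst u) * (fst y \<bullet> fst y)"
    using Cauchy_Schwarz_ineq[of "fst u" "fst y"] by (simp add: power_mult_distrib)
  also have "\<dots> \<le> (fst u \<bullet> fst u) * (snd y)\<^sup>2 - fst u \<bullet> fst u"
    by (simp add: yy algebra_simps)
  finally have *: "(snd u)\<^sup>2 * (snd y)\<^sup>2 + fst u \<bullet> fst u \<le> (fst u \<bullet> fst u) * (snd y)\<^sup>2" by simp
  have "0 \<le> (lor u u) * (snd y)\<^sup>2 - fst u \<bullet> fst u"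
    using * by (simp add: lor_def power2_eq_square algebra_simps)
  then have ge: "fst u \<bullet> fst u \<le> lor u u * (snd y)\<^sup>2" by simp
  then have "lor u u \<ge> 0" using pos inner_ge_zero[of "fst u"]
    by (meson less_le_trans not_le order_trans zero_less_one mult_neg_pos)
  then have "(snd u)\<^sup>2 \<le> fst u \<bullet> fst u" by (simp add: lor_def power2_eq_square)
  then have "(snd u)\<^sup>2 \<le> lor u u * (snd y)\<^sup>2" using ge by linarith
  then show "lor u u \<ge> (snd u)\<^sup>2 / (snd y)\<^sup>2"
    using pos \<open>snd y \<noteq> 0\<close> by (simp add: divide_le_eq)
qed

lemma lor_orth_nonneg:
  assumes "lor y y = -1" "lor u y = 0" shows "lor u u \<ge> 0"
  using lor_timelike_orth[OF assms] by (meson order_trans zero_le_divide_iff zero_le_power2)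

lemma lor_orth_eq_0:
  assumes "lor y y = -1" "lor u y = 0" "lor u u = 0" shows "u = 0"
proof -
  have "snd u = 0"
    using lor_timelike_orth[OF assms(1,2)] assms(3)
    by (simp add: divide_le_0_iff)
  then show ?thesis using assms(3) by (simp add: lor_def prod_eq_iff)
qed

lemma lor_orth_Cauchy_Schwarz:
  assumes y: "lor y y = -1" and u: "lor u y = 0" and v: "lor v y = 0"
  shows "(lor u v)\<^sup>2 \<le> lor u u * lor v v"
proof (cases "lor v v = 0")
  case True
  then show ?thesis using lor_orth_eq_0[OF y v] by (simp add: lor_def)
next
  case False
  then have vv: "lor v v > 0" using lor_orth_nonneg[OF y v] by simp
  let ?w = "lor v v *\<^sub>R u - lor u v *\<^sub>R v"
  have "0 \<le> lor ?w ?w" by (rule lor_orth_nonneg[OF y]) (simp add: lor_algebra u v)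
  also have "\<dots> = lor v v * (lor u u * lor v v - (lor u v)\<^sup>2)"
    by (simp add: lor_algebra lor_commute[of v u] power2_eq_square algebra_simps)
  finally show ?thesis using vv by (simp add: zero_le_mult_iff)
qed

lemma lor_eq_minus_1D: "lor (a, s) (a, s) = -1 \<Longrightarrow> s\<^sup>2 = 1 + (norm a)\<^sup>2"
  by (simp add: lor_def power2_norm_eq_inner) (simp add: power2_eq_square)

lemma lor_Rep_hyp_le: "- lor (Rep_hyp x) (Rep_hyp y) \<ge> 1"
proof -
  obtain a s b t where xy: "Rep_hyp x = (a, s)" "Rep_hyp y = (b, t)" by (metis surj_pair)
  have s: "s > 0" "s\<^sup>2 = 1 + (norm a)\<^sup>2" and t: "t > 0" "t\<^sup>2 = 1 + (norm b)\<^sup>2"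
    using lor_Rep_hyp[of x] snd_Rep_hyp[of x] lor_Rep_hyp[of y] snd_Rep_hyp[of y]
      lor_eq_minus_1D[of a s] lor_eq_minus_1D[of b t]
    by (simp_all add: xy)
  have "(1 + norm a * norm b)\<^sup>2 \<le> (s * t)\<^sup>2"
    using sum_squares_bound[of "norm a" "norm b"]
    by (simp add: power_mult_distrib s(2) t(2)) (simp add: power2_eq_square algebra_simps)
  then have "1 + norm a * norm b \<le> s * t"
    using s(1) t(1) by (meson less_imp_le mult_pos_pos power2_le_imp_le)
  then show ?thesis using norm_cauchy_schwarz[of a b] by (simp add: xy lor_def)
qed

instantiation hyp :: (euclidean_space) metric_space
begin

definition dist_hyp_def: "dist x y = arcosh (- lor (Rep_hyp x) (Rep_hyp y))"

definition uniformity_hyp_def: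
  "(uniformity :: ('a hyp \<times> 'a hyp) filter) = (INF e\<in>{0 <..}. principal {(x, y). dist x y < e})"

definition open_hyp_def:
  "open (U :: 'a hyp set) = (\<forall>x\<in>U. eventually (\<lambda>(x', y). x' = x \<longrightarrow> y \<in> U) uniformity)"

instance
proof
  fix x y z :: "'a hyp"
  let ?x = "Rep_hyp x" and ?y = "Rep_hyp y" and ?z = "Rep_hyp z"
  show "dist x y = 0 \<longleftrightarrow> x = y"
  proof
    assume "dist x y = 0"
    then have "- lor ?x ?y = cosh 0"
      using cosh_arcosh_real[OF lor_Rep_hyp_le[of x y]] by (simp add: dist_hyp_def)
    then have 1: "lor ?x ?y = -1" by simp
    have "?x - ?y = 0"
      by (rule lor_orth_eq_0[OF lor_Rep_hyp[of y]])
        (simp_all add: lor_algebra lor_Rep_hyp 1 lor_commute[of ?y ?x])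
    then show "x = y" by (simp add: Rep_hyp_inject)
  qed (simp add: dist_hyp_def lor_Rep_hyp)
  define p q r where "p = - lor ?x ?z" and "q = - lor ?y ?z" and "r = - lor ?x ?y"
  have ge: "p \<ge> 1" "q \<ge> 1" "r \<ge> 1" by (simp_all only: p_def q_def r_def lor_Rep_hyp_le)
  define u v where "u = ?x - p *\<^sub>R ?z" and "v = ?y - q *\<^sub>R ?z"
  have o: "lor u ?z = 0" "lor v ?z = 0"
    by (simp_all add: u_def v_def lor_algebra lor_Rep_hyp p_def q_def)
  have uu: "lor u u = p\<^sup>2 - 1" and vv: "lor v v = q\<^sup>2 - 1" and uv: "lor u v = p * q - r"
    by (simp_all add: u_def v_def lor_algebra lor_Rep_hyp p_def q_def r_def
        lor_commute[of ?z ?x] lor_commute[of ?z ?y] lor_commute[of ?y ?x] power2_eq_square)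
  have sh: "sinh (arcosh c) = sqrt (c\<^sup>2 - 1)" if "c \<ge> 1" for c :: real
    using that by (simp add: sinh_arcosh_real)
  have "(p * q - r)\<^sup>2 \<le> (p\<^sup>2 - 1) * (q\<^sup>2 - 1)"
    using lor_orth_Cauchy_Schwarz[OF lor_Rep_hyp[of z] o] by (simp only: uu vv uv)
  then have "\<bar>p * q - r\<bar> \<le> sqrt ((p\<^sup>2 - 1) * (q\<^sup>2 - 1))"
    by (simp add: real_le_rsqrt)
  then have "r \<le> p * q + sqrt (p\<^sup>2 - 1) * sqrt (q\<^sup>2 - 1)"
    by (simp add: real_sqrt_mult)
  also have "\<dots> = cosh (arcosh p + arcosh q)"
    using ge by (simp add: cosh_add sh)
  finally have "cosh (arcosh r) \<le> cosh (arcosh p + arcosh q)"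
    using ge by simp
  then have "arcosh r \<le> arcosh p + arcosh q"
    using ge by (subst (asm) cosh_real_nonneg_le_iff) simp_all
  then show "dist x y \<le> dist x z + dist y z"
    by (simp add: dist_hyp_def p_def q_def r_def)
qed (simp_all add: uniformity_hyp_def open_hyp_def)

end

definition isometry_group :: "('a::euclidean_space hyp \<Rightarrow> 'a hyp) monoid" where
  "isometry_group =
    \<lparr>carrier = {f. bij f \<and> (\<forall>x y. dist (f x) (f y) = dist x y)}, mult = (\<circ>), one = id\<rparr>"

lemma group_isometry_group: "group isometry_group"
proof (rule groupI)
  fix f :: "'a hyp \<Rightarrow> 'a hyp" assume f: "f \<in> carrier isometry_group"
  have "dist (Hilbert_Choice.inv f x) (Hilbert_Choice.inv f y) = dist x y" for x y
    using f unfolding isometry_group_def by simp (metis bij_inv_eq_iff)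
  then show "\<exists>g\<in>carrier isometry_group. g \<otimes>\<^bsub>isometry_group\<^esub> f = \<one>\<^bsub>isometry_group\<^esub>"
    using f by (intro bexI[of _ "Hilbert_Choice.inv f"])
      (auto simp: isometry_group_def bij_imp_bij_inv bij_is_inj)
qed (auto simp: isometry_group_def bij_comp comp_assoc)


section \<open>Hyperplanes, half-spaces and reflections\<close>

text \<open>Hyperplanes and closed half-spaces are given by a spacelike unit normal \<open>e\<close>.\<close>

definition hyperplane :: "'a::euclidean_space \<times> real \<Rightarrow> 'a hyp set" where
  "hyperplane e = {x. lor (Rep_hyp x) e = 0}"

definition halfspace :: "'a::euclidean_space \<times> real \<Rightarrow> 'a hyp set" where
  "halfspace e = {x. lor (Rep_hyp x) e \<le> 0}"

definition hrefl :: "'a::euclidean_space \<times> real \<Rightarrow> 'a hyp \<Rightarrow> 'a hyp" where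
  "hrefl e x = Abs_hyp (Rep_hyp x - (2 * lor (Rep_hyp x) e) *\<^sub>R e)"

lemma Rep_hrefl:
  assumes e: "lor e e = 1"
  shows "Rep_hyp (hrefl e x) = Rep_hyp x - (2 * lor (Rep_hyp x) e) *\<^sub>R e"
proof -
  define y where "y = Rep_hyp x - (2 * lor (Rep_hyp x) e) *\<^sub>R e"
  obtain a s b t where xy: "Rep_hyp x = (a, s)" "y = (b, t)" by (metis surj_pair)
  have yy: "lor y y = -1"
    by (simp add: y_def lor_algebra lor_Rep_hyp e lor_commute[of e "Rep_hyp x"])
  have "lor (Rep_hyp x) y = -1 - 2 * (lor (Rep_hyp x) e)\<^sup>2"
    by (simp add: y_def lor_algebra lor_Rep_hyp power2_eq_square)
  then have "lor (Rep_hyp x) y < 0"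
    using zero_le_power2[of "lor (Rep_hyp x) e"] by linarith
  then have neg: "a \<bullet> b < s * t" by (simp add: xy lor_def)
  have s: "s > 0" "s\<^sup>2 = 1 + (norm a)\<^sup>2" and t: "t\<^sup>2 = 1 + (norm b)\<^sup>2"
    using lor_Rep_hyp[of x] snd_Rep_hyp[of x] yy lor_eq_minus_1D[of a s] lor_eq_minus_1D[of b t]
    by (simp_all add: xy)
  have "t > 0"
  proof (rule ccontr)
    assume "\<not> t > 0"
    then have "norm b \<le> - t" using t by - (rule power2_le_imp_le, simp_all)
    moreover have "norm a \<le> s" using s by - (rule power2_le_imp_le, simp_all)
    ultimately have "norm a * norm b \<le> s * - t" using s(1) by (intro mult_mono) auto
    moreover have "- (a \<bullet> b) \<le> norm a * norm b"
      using norm_cauchy_schwarz[of "- a" b] by simp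
    ultimately show False using neg by simp
  qed
  then have "y \<in> {p. lor p p = -1 \<and> snd p > 0}" using yy by (simp add: xy)
  then show ?thesis unfolding hrefl_def y_def[symmetric] by (rule Abs_hyp_inverse)
qed

lemma hrefl_in_isometry_group:
  assumes e: "lor e e = 1"
  shows "hrefl e \<in> carrier isometry_group"
proof -
  have "hrefl e (hrefl e x) = x" for x
    by (simp add: Rep_hyp_inject[symmetric] Rep_hrefl[OF e] lor_algebra e)
  then have "bij (hrefl e)" by (intro o_bij[of "hrefl e"]) auto
  moreover have "dist (hrefl e x) (hrefl e y) = dist x y" for x y
    by (simp add: dist_hyp_def Rep_hrefl[OF e] lor_algebra e lor_commute[of e "Rep_hyp y"])
  ultimately show ?thesis by (simp add: isometry_group_def)
qed

definition is_reflection :: "('a::euclidean_space hyp \<Rightarrow> 'a hyp) \<Rightarrow> bool" where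
  "is_reflection f \<longleftrightarrow> (\<exists>e. lor e e = 1 \<and> f = hrefl e)"


section \<open>Polyhedra\<close>

text \<open>Infinitely many bounding hyperplanes are allowed, provided that they are locally finite.\<close>

definition convex_polyhedron :: "'a::euclidean_space hyp set \<Rightarrow> bool" where
  "convex_polyhedron P \<longleftrightarrow>
    (\<exists>E. (\<forall>e\<in>E. lor e e = 1) \<and> P = (\<Inter>e\<in>E. halfspace e) \<and>
         (\<forall>x. \<exists>r>0. finite {e\<in>E. hyperplane e \<inter> ball x r \<noteq> {}}))"

text \<open>
  The least totally geodesic subspace containing \<open>S\<close> is cut out by the linear span of \<open>S\<close>,
  so its codimension in hyperbolic space is that of the span in Minkowski space.
\<close>

definition hcodim :: "'a::euclidean_space hyp set \<Rightarrow> nat" where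
  "hcodim S = DIM('a \<times> real) - dim (Rep_hyp ` S)"

definition outward_normal :: "'a::euclidean_space hyp set \<Rightarrow> 'a hyp set \<Rightarrow> 'a \<times> real \<Rightarrow> bool" where
  "outward_normal P F e \<longleftrightarrow> lor e e = 1 \<and> P \<subseteq> halfspace e \<and> F = P \<inter> hyperplane e"

definition wall :: "'a::euclidean_space hyp set \<Rightarrow> 'a hyp set \<Rightarrow> bool" where
  "wall P F \<longleftrightarrow> (\<exists>e. outward_normal P F e) \<and> hcodim F = 1"

text \<open>The normal of a wall is unique when \<open>P\<close> has nonempty interior.\<close>

definition wall_normal :: "'a::euclidean_space hyp set \<Rightarrow> 'a hyp set \<Rightarrow> 'a \<times> real" where
  "wall_normal P F = (THE e. outward_normal P F e)"

text \<open>
  At a common point of two walls the outward normals are unit tangent vectors, and the angle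
  inside \<open>P\<close> is \<open>\<pi>\<close> minus the angle between them.  The value is used only for walls that meet.
\<close>

definition dihedral_angle :: "'a::euclidean_space hyp set \<Rightarrow> 'a hyp set \<Rightarrow> 'a hyp set \<Rightarrow> real" where
  "dihedral_angle P F G = pi - arccos (lor (wall_normal P F) (wall_normal P G))"

text \<open>
  Dihedral angles of a polyhedron sit at its faces of codimension two.  Nonemptiness is
  required separately because in dimension one the empty set also has \<open>hcodim\<close> equal to two.
\<close>

definition coxeter_polyhedron :: "'a::euclidean_space hyp set \<Rightarrow> bool" where
  "coxeter_polyhedron P \<longleftrightarrow> convex_polyhedron P \<and> interior P \<noteq> {} \<and>
    (\<forall>F G. wall P F \<longrightarrow> wall P G \<longrightarrow> F \<inter> G \<noteq> {} \<longrightarrow> hcodim (F \<inter> G) = 2 \<longrightarrow>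
       (\<exists>m::nat. m \<ge> 2 \<and> dihedral_angle P F G = pi / real m))"

definition doubling_wall :: "'a::euclidean_space hyp set \<Rightarrow> 'a hyp set \<Rightarrow> bool" where
  "doubling_wall P F \<longleftrightarrow> wall P F \<and>
    (\<forall>G. wall P G \<longrightarrow> G \<noteq> F \<longrightarrow> F \<inter> G \<noteq> {} \<longrightarrow>
       (\<exists>m::nat. m \<ge> 2 \<and> even m \<and> dihedral_angle P F G = pi / real m))"

definition redoublable :: "'a::euclidean_space hyp set \<Rightarrow> bool" where
  "redoublable P \<longleftrightarrow> coxeter_polyhedron P \<and>
    (\<exists>F G. doubling_wall P F \<and> doubling_wall P G \<and> F \<inter> G = {})"

definition coxeter_group :: "'a::euclidean_space hyp set \<Rightarrow> ('a hyp \<Rightarrow> 'a hyp) monoid" where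
  "coxeter_group P = subgroup_generated isometry_group {hrefl (wall_normal P F) | F. wall P F}"

end

theory Submission
  imports Defs
begin

text \<open>
  The group \<open>W\<close> acts on a path with vertices \<open>0, ..., I - 1\<close>.  The reflection in one of the two
  disjoint doubling walls exchanges \<open>0, 1\<close> and \<open>2, 3\<close> and so on, the reflection in the other one
  exchanges \<open>1, 2\<close> and \<open>3, 4\<close> and so on, and the reflections in all other walls act trivially.
  The action is transitive, so the stabiliser of the vertex \<open>0\<close> has index \<open>I\<close>.  It is generated
  by reflections: a wall reflection either moves a vertex along the path, and then contributes
  nothing to Schreier's generators for the alternating words in the two special reflections, or
  it fixes the vertex, and then the contribution is a conjugate of this reflection
  (\<open>stab_induct\<close>).  Geometrically, the stabiliser is the reflection group of the union of \<open>I\<close>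
  consecutive images of \<open>Q\<close> under the infinite dihedral group of the two walls.

  It has to be shown that the action is well defined, that is, that a word in the wall
  reflections that is trivial on hyperbolic space is trivial on the path.  The wall reflections
  are made to act on both simultaneously.  Tits's lemma (\<open>act_eq_id_if_meets_chamber\<close>) says that
  a product of reflections that maps a point of the open chamber into the chamber is the
  identity, provided that the group generated by any two of the reflections behaves like a
  dihedral group acting on a wedge.  It applies to the simultaneous action because the relation
  of order \<open>m\<close> between two reflections holds on the path as well: both act trivially, or only
  one of them does not and \<open>m\<close> is even (\<open>path_relation\<close>).

  For the condition on pairs, the Lorentz product of two outward unit normals must be \<open>- cos (pi
  / m)\<close> or at most \<open>-1\<close>.  The definition of a Coxeter polyhedron only speaks of pairs of walls
  that share a face of codimension two.  That this covers all walls that meet is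
  \<open>meeting_walls_adjacent\<close>, and that the product is at most \<open>-1\<close> for walls that do not meet is
  \<open>lor_le_minus_1_if_disjoint\<close>.  Both rest on the fact that a wall is locally cut out of its
  hyperplane by the walls that are adjacent to it in codimension two
  (\<open>wall_cone_cut_out_by_adjacent\<close>), so that Farkas' lemma expresses suitable vectors by the
  normals of adjacent walls, whose products have a known sign.
\<close>

section \<open>Words in involutions and Tits's lemma\<close>

definition act :: "('s \<Rightarrow> 'b \<Rightarrow> 'b) \<Rightarrow> 's list \<Rightarrow> 'b \<Rightarrow> 'b" where
  "act T ws = foldr (\<lambda>s g. T s \<circ> g) ws id"

lemma act_simps [simp]: "act T [] = id" "act T (s # ws) = T s \<circ> act T ws"
  by (simp_all add: act_def)

lemma act_append [simp]: "act T (us @ ws) = act T us \<circ> act T ws"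
  by (induction us) (simp_all add: comp_assoc)

lemma act_rev_cancel:
  assumes "\<And>s x. s \<in> set ws \<Longrightarrow> T s (T s x) = x"
  shows "act T (rev ws) (act T ws x) = x" and "act T ws (act T (rev ws) x) = x"
proof -
  have *: "act T (rev us) (act T us y) = y" if "set us \<subseteq> set ws" for us y
    using that assms by (induction us arbitrary: y) simp_all
  show "act T (rev ws) (act T ws x) = x" using *[of ws] by simp
  show "act T ws (act T (rev ws) x) = x" using *[of "rev ws"] by simp
qed

text \<open>
  The word length of a map with respect to the generators in \<open>X\<close>; it is only used for maps that
  are products of such generators.  The lengths with respect to all generators and with respect
  to two of them occur side by side, hence the argument \<open>X\<close>.
\<close>

definition wlen :: "('s \<Rightarrow> 'b \<Rightarrow> 'b) \<Rightarrow> 's set \<Rightarrow> ('b \<Rightarrow> 'b) \<Rightarrow> nat" where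
  "wlen T X g = (LEAST n. \<exists>ws. set ws \<subseteq> X \<and> length ws = n \<and> act T ws = g)"

lemma wlen_le: "set ws \<subseteq> X \<Longrightarrow> wlen T X (act T ws) \<le> length ws"
  unfolding wlen_def by (rule Least_le) blast

lemma wlen_witness:
  assumes "set ws \<subseteq> X"
  obtains us where "set us \<subseteq> X" "length us = wlen T X (act T ws)" "act T us = act T ws"
proof -
  have "\<exists>us. set us \<subseteq> X \<and> length us = wlen T X (act T ws) \<and> act T us = act T ws"
    unfolding wlen_def by (rule LeastI) (use assms in blast)
  then show thesis using that by blast
qed

lemma wlen_comp_le:
  assumes "set us \<subseteq> X" "set vs \<subseteq> X"
  shows "wlen T X (act T us \<circ> act T vs) \<le> wlen T X (act T us) + wlen T X (act T vs)"
proof -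
  obtain us' where us': "set us' \<subseteq> X" "length us' = wlen T X (act T us)" "act T us' = act T us"
    using wlen_witness[OF assms(1)] .
  obtain vs' where vs': "set vs' \<subseteq> X" "length vs' = wlen T X (act T vs)" "act T vs' = act T vs"
    using wlen_witness[OF assms(2)] .
  show ?thesis using wlen_le[of "us' @ vs'" X T] us' vs' by simp
qed

lemma wlen_mono: "set ws \<subseteq> X \<Longrightarrow> X \<subseteq> Y \<Longrightarrow> wlen T Y (act T ws) \<le> wlen T X (act T ws)"
  using wlen_witness[of ws X T] wlen_le[of _ Y T] by (metis order_trans)

text \<open>
  \<open>A s\<close> plays the role of the open half-space on the inner side of the wall of \<open>s\<close>.  The
  assumption \<open>rank_two\<close> is the conclusion of the lemma restricted to the subgroup generated by
  two of the reflections, with the length of that subgroup; everything below passes from two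
  generators to all of them.  The maps \<open>T s\<close> generate a concrete group of permutations: no
  presentation of that group is assumed.
\<close>

locale tits_chamber =
  fixes T :: "'s \<Rightarrow> 'b \<Rightarrow> 'b" and S :: "'s set" and A :: "'s \<Rightarrow> 'b set"
  assumes involution: "s \<in> S \<Longrightarrow> T s (T s x) = x"
    and disjoint_sides: "s \<in> S \<Longrightarrow> x \<in> A s \<Longrightarrow> T s x \<notin> A s"
    and rank_two: "s \<in> S \<Longrightarrow> t \<in> S \<Longrightarrow> s \<noteq> t \<Longrightarrow> set us \<subseteq> {s, t} \<Longrightarrow>
      (\<forall>x\<in>A s \<inter> A t. act T us x \<in> A s) \<or>
      (\<forall>x\<in>A s \<inter> A t. T s (act T us x) \<in> A s) \<and>
        wlen T {s, t} (T s \<circ> act T us) < wlen T {s, t} (act T us)"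
begin

definition chamber :: "'b set" where "chamber = (\<Inter>s\<in>S. A s)"

text \<open>
  One half of a simultaneous induction on word length.  The clause on lengths turns the
  geometric alternative into the combinatorial one that the induction needs.
\<close>

definition halfspace_property :: "'s list \<Rightarrow> bool" where
  "halfspace_property ws \<longleftrightarrow> (\<forall>s\<in>S. (\<forall>x\<in>chamber. act T ws x \<in> A s) \<or>
     (\<forall>x\<in>chamber. T s (act T ws x) \<in> A s) \<and> wlen T S (T s \<circ> act T ws) < wlen T S (act T ws))"

text \<open>
  The other half of the induction.  As the lengths add up along the decomposition, a reflection
  that shortens the factor in the two-generator group also shortens the whole word.
\<close>

definition wedge_property :: "'s list \<Rightarrow> bool" where
  "wedge_property ws \<longleftrightarrow> (\<forall>s\<in>S. \<forall>t\<in>S. s \<noteq> t \<longrightarrow> (\<exists>us. set us \<subseteq> {s, t} \<and>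
     (\<forall>x\<in>chamber. act T (rev us) (act T ws x) \<in> A s \<inter> A t) \<and>
     wlen T S (act T ws) = wlen T {s, t} (act T us) + wlen T S (act T (rev us @ ws))))"

lemma act_cancel:
  assumes "set ws \<subseteq> S"
  shows "act T (rev ws) (act T ws x) = x" "act T ws (act T (rev ws) x) = x"
  using act_rev_cancel[of ws T x] assms involution by auto

lemma wlen_step:
  assumes "set ws \<subseteq> S" "s \<in> S"
  shows "wlen T S (act T ws) \<le> Suc (wlen T S (T s \<circ> act T ws))"
proof -
  have "act T ws = act T [s] \<circ> act T (s # ws)"
    using involution[OF assms(2)] by (auto simp: fun_eq_iff)
  then have "wlen T S (act T ws) \<le> wlen T S (act T [s]) + wlen T S (act T (s # ws))"
    using wlen_comp_le[of "[s]" S "s # ws" T] assms by simp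
  also have "wlen T S (act T [s]) \<le> 1" using wlen_le[of "[s]" S T] assms by simp
  finally show ?thesis by (simp add: comp_def)
qed

text \<open>
  Write the word as a reduced word \<open>t # vs\<close>.  If \<open>s = t\<close>, the half-space property of \<open>vs\<close> for
  the wall of \<open>t\<close> decides the claim.  Otherwise the wedge property of \<open>vs\<close> for \<open>s\<close> and \<open>t\<close>
  reduces it to the two-generator group, where it is an assumption.
\<close>

lemma halfspace_step:
  assumes n: "\<And>us. set us \<subseteq> S \<Longrightarrow> wlen T S (act T us) = n \<Longrightarrow> halfspace_property us \<and> wedge_property us"
    and ws: "set ws \<subseteq> S" "wlen T S (act T ws) = Suc n"
  shows "halfspace_property ws"
  unfolding halfspace_property_def
proof
  fix s assume s: "s \<in> S"
  obtain us where us: "set us \<subseteq> S" "length us = Suc n" "act T us = act T ws"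
    using wlen_witness[OF ws(1), of T] ws(2) by metis
  then obtain t vs where vs: "us = t # vs" "length vs = n" "set vs \<subseteq> S" "t \<in> S"
    by (cases us) auto
  have w: "act T ws = T t \<circ> act T vs" using us vs by simp
  have lv: "wlen T S (act T vs) = n"
  proof (rule antisym)
    show "wlen T S (act T vs) \<le> n" using wlen_le[of vs S T] vs by simp
    show "n \<le> wlen T S (act T vs)"
      using wlen_step[OF ws(1) vs(4)] involution[OF vs(4)] ws(2)
      by (simp add: w comp_def)
  qed
  note IH = n[OF vs(3) lv]
  show "(\<forall>x\<in>chamber. act T ws x \<in> A s) \<or>
     (\<forall>x\<in>chamber. T s (act T ws x) \<in> A s) \<and> wlen T S (T s \<circ> act T ws) < wlen T S (act T ws)"
  proof (cases "s = t")
    case True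
    have "wlen T S (T t \<circ> act T vs) = Suc n" using ws w by simp
    then have "\<forall>x\<in>chamber. act T vs x \<in> A t"
      using IH vs(4) lv unfolding halfspace_property_def by fastforce
    moreover have "T t \<circ> act T ws = act T vs" using involution[OF vs(4)] by (auto simp: w)
    ultimately show ?thesis using True ws lv by (auto simp: w involution vs(4))
  next
    case False
    obtain u where u: "set u \<subseteq> {s, t}"
      "\<And>x. x \<in> chamber \<Longrightarrow> act T (rev u) (act T vs x) \<in> A s \<inter> A t"
      "wlen T S (act T vs) = wlen T {s, t} (act T u) + wlen T S (act T (rev u @ vs))"
      using IH s vs(4) False unfolding wedge_property_def by meson
    have uS: "set u \<subseteq> S" using u(1) s vs(4) by auto
    have wx: "act T ws x = act T (t # u) (act T (rev u) (act T vs x))" for x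
      by (simp add: w act_cancel[OF uS])
    have tu: "set (t # u) \<subseteq> {s, t}" using u by auto
    from rank_two[OF s vs(4) False tu] show ?thesis
    proof (elim disjE conjE)
      assume "\<forall>x\<in>A s \<inter> A t. act T (t # u) x \<in> A s"
      then show ?thesis using u(2) by (auto simp only: wx)
    next
      assume 1: "\<forall>x\<in>A s \<inter> A t. T s (act T (t # u) x) \<in> A s"
        and 2: "wlen T {s, t} (T s \<circ> act T (t # u)) < wlen T {s, t} (act T (t # u))"
      have "T s \<circ> act T ws = act T (s # t # u) \<circ> act T (rev u @ vs)"
        by (simp add: fun_eq_iff w act_cancel[OF uS])
      then have "wlen T S (T s \<circ> act T ws) \<le> wlen T S (act T (s # t # u)) + wlen T S (act T (rev u @ vs))"
        using wlen_comp_le[of "s # t # u" S "rev u @ vs" T] uS s vs by simp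
      also have "wlen T S (act T (s # t # u)) \<le> wlen T {s, t} (act T (s # t # u))"
        using tu s vs(4) by (intro wlen_mono) auto
      also have "\<dots> < wlen T {s, t} (act T (t # u))" using 2 by simp
      also have "\<dots> \<le> Suc (wlen T {s, t} (act T u))"
        using wlen_comp_le[of "[t]" "{s, t}" u T] wlen_le[of "[t]" "{s, t}" T] u(1) by simp
      finally have "wlen T S (T s \<circ> act T ws) < Suc n" using u(3) lv by (simp add: comp_def)
      then show ?thesis using 1 u(2) ws(2) by (simp only: wx) auto
    qed
  qed
qed

text \<open>
  If the image of the chamber does not lie in the wedge itself, the half-space property shows
  that one of the two reflections shortens the word; the wedge property of the shorter word then
  gives that of the given one.
\<close>

lemma wedge_step:
  assumes n: "\<And>us. set us \<subseteq> S \<Longrightarrow> wlen T S (act T us) = n \<Longrightarrow> wedge_property us"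
    and ws: "set ws \<subseteq> S" "wlen T S (act T ws) = Suc n" and half: "halfspace_property ws"
  shows "wedge_property ws"
proof -
  have key: "\<exists>us. set us \<subseteq> {s, t} \<and>
     (\<forall>x\<in>chamber. act T (rev us) (act T ws x) \<in> A s \<inter> A t) \<and>
     wlen T S (act T ws) = wlen T {s, t} (act T us) + wlen T S (act T (rev us @ ws))"
    if s: "s \<in> S" and t: "t \<in> S" and st: "s \<noteq> t" and
      lt: "wlen T S (T s \<circ> act T ws) < wlen T S (act T ws)" for s t
  proof -
    have ls: "wlen T S (act T (s # ws)) = n"
      using wlen_step[OF ws(1) s] lt ws(2) by simp
    then obtain v where v: "set v \<subseteq> {s, t}"
      "\<And>x. x \<in> chamber \<Longrightarrow> act T (rev v) (act T (s # ws) x) \<in> A s \<inter> A t"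
      "wlen T S (act T (s # ws)) = wlen T {s, t} (act T v) + wlen T S (act T (rev v @ s # ws))"
      using n[of "s # ws"] ws(1) s t st unfolding wedge_property_def
      by (metis insert_subset list.simps(15))
    have vS: "set v \<subseteq> S" using v(1) s t by auto
    have "wlen T S (act T ws) = wlen T {s, t} (act T (s # v)) + wlen T S (act T (rev (s # v) @ ws))"
    proof (rule antisym)
      have "act T ws = act T (s # v) \<circ> act T (rev (s # v) @ ws)"
        by (simp add: fun_eq_iff act_cancel[OF vS] involution[OF s])
      then have "wlen T S (act T ws) \<le> wlen T S (act T (s # v)) + wlen T S (act T (rev (s # v) @ ws))"
        using wlen_comp_le[of "s # v" S "rev (s # v) @ ws" T] vS s ws(1) by simp
      also have "wlen T S (act T (s # v)) \<le> wlen T {s, t} (act T (s # v))"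
        using v(1) s t by (intro wlen_mono) auto
      finally show "wlen T S (act T ws) \<le> wlen T {s, t} (act T (s # v)) + wlen T S (act T (rev (s # v) @ ws))"
        by (simp add: comp_def)
      have "wlen T {s, t} (act T (s # v)) \<le> Suc (wlen T {s, t} (act T v))"
        using wlen_comp_le[of "[s]" "{s, t}" v T] wlen_le[of "[s]" "{s, t}" T] v(1) by simp
      then show "wlen T {s, t} (act T (s # v)) + wlen T S (act T (rev (s # v) @ ws)) \<le> wlen T S (act T ws)"
        using v(3) ls ws(2) by (simp add: comp_assoc)
    qed
    then show ?thesis using v by (intro exI[of _ "s # v"]) auto
  qed
  show ?thesis unfolding wedge_property_def
  proof (intro ballI impI)
    fix s t assume st: "s \<in> S" "t \<in> S" "s \<noteq> t"
    consider "\<forall>x\<in>chamber. act T ws x \<in> A s \<inter> A t"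
      | "wlen T S (T s \<circ> act T ws) < wlen T S (act T ws)"
      | "wlen T S (T t \<circ> act T ws) < wlen T S (act T ws)"
      using half st unfolding halfspace_property_def by blast
    then show "\<exists>us. set us \<subseteq> {s, t} \<and>
     (\<forall>x\<in>chamber. act T (rev us) (act T ws x) \<in> A s \<inter> A t) \<and>
     wlen T S (act T ws) = wlen T {s, t} (act T us) + wlen T S (act T (rev us @ ws))"
    proof cases
      case 1
      then show ?thesis using wlen_le[of "[]" "{s, t}" T] by (intro exI[of _ "[]"]) auto
    next
      case 2
      then show ?thesis using key st by blast
    next
      case 3
      then show ?thesis using key[of t s] st by (auto simp: insert_commute)
    qed
  qed
qed

lemma tits_properties:
  assumes "set ws \<subseteq> S"
  shows "halfspace_property ws \<and> wedge_property ws"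
proof -
  have "set ws \<subseteq> S \<Longrightarrow> wlen T S (act T ws) = n \<Longrightarrow> halfspace_property ws \<and> wedge_property ws" for n
  proof (induction n arbitrary: ws)
    case 0
    obtain us where "length us = 0" "act T us = act T ws"
      using wlen_witness[OF 0(1), of T] 0(2) by metis
    then have id: "act T ws = id" by auto
    have l0: "wlen T X (id :: 'b \<Rightarrow> 'b) = 0" for X using wlen_le[of "[]" X T] by simp
    have "halfspace_property ws"
      unfolding halfspace_property_def by (auto simp: id chamber_def)
    moreover have "wedge_property ws"
      unfolding wedge_property_def using l0
      by (auto simp: id chamber_def intro!: exI[of _ "[]"])
    ultimately show ?case by blast
  next
    case (Suc n)
    then show ?case using halfspace_step wedge_step by metis
  qed
  then show ?thesis using assms by blast
qed

text \<open>
  A reduced nonempty word \<open>s # vs\<close> moves the chamber to the far side of the wall of \<open>s\<close>: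
  otherwise \<open>vs\<close> would do so and \<open>s # vs\<close> would be shorter than \<open>vs\<close>.  So it maps no point of
  the chamber into the chamber.
\<close>

theorem act_eq_id_if_meets_chamber:
  assumes ws: "set ws \<subseteq> S" and x: "x \<in> chamber" "act T ws x \<in> chamber"
  shows "act T ws = id"
proof -
  obtain us where us: "set us \<subseteq> S" "length us = wlen T S (act T ws)" "act T us = act T ws"
    using wlen_witness[OF ws] .
  show ?thesis
  proof (cases us)
    case Nil
    then show ?thesis using us(3) by simp
  next
    case (Cons s vs)
    then have s: "s \<in> S" using us(1) by auto
    have "wlen T S (act T vs) < wlen T S (act T ws)"
      using wlen_le[of vs S T] us(1,2) Cons by simp
    moreover have "set vs \<subseteq> S" using us(1) Cons by simp
    ultimately have "\<not> wlen T S (T s \<circ> act T vs) < wlen T S (act T vs)"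
      using us(3) Cons by auto
    then have "act T vs x \<in> A s"
      using tits_properties[OF \<open>set vs \<subseteq> S\<close>] x(1) s unfolding halfspace_property_def by blast
    then have "T s (act T vs x) \<notin> A s" using disjoint_sides[OF s] by blast
    moreover have "T s (act T vs x) = act T ws x" using us(3) Cons by (metis act_simps(2) comp_apply)
    ultimately show ?thesis using x(2) s by (auto simp: chamber_def)
  qed
qed

end

section \<open>Linear algebra of the Lorentz form\<close>

text \<open>
  The Euclidean normal vector of the linear hyperplane that is Lorentz orthogonal to the
  argument; it makes results on Euclidean polyhedra and separation applicable.
\<close>

definition dual_normal :: "'a::euclidean_space \<times> real \<Rightarrow> 'a \<times> real" where
  "dual_normal e = (fst e, - snd e)"

lemma lor_eq_inner: "lor x e = dual_normal e \<bullet> x"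
  by (simp add: lor_def dual_normal_def inner_prod_def inner_commute)

lemma dual_normal_eq_0 [simp]: "dual_normal e = 0 \<longleftrightarrow> e = 0"
  by (auto simp: dual_normal_def prod_eq_iff)

lemma lor_zero [simp]: "lor 0 x = 0" "lor x 0 = 0"
  by (simp_all add: lor_def)

lemma lor_minus [simp]: "lor (- x) y = - lor x y" "lor x (- y) = - lor x y"
  by (simp_all add: lor_def)

lemma lor_nondegenerate:
  assumes "\<And>x. lor x z = 0" shows "z = 0"
  using assms[of "dual_normal z"] by (simp add: lor_eq_inner)

lemma continuous_on_lor [continuous_intros]:
  assumes "continuous_on S f" "continuous_on S g"
  shows "continuous_on S (\<lambda>x. lor (f x) (g x))"
  unfolding lor_def by (intro continuous_intros assms)

lemma subspace_lor_orth: "subspace {x. lor x e = 0}"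
  by (auto simp: subspace_def lor_algebra)

lemma dim_lor_orth:
  fixes e :: "'a::euclidean_space \<times> real"
  assumes "e \<noteq> 0" shows "dim {x. lor x e = 0} = DIM('a)"
  using dim_hyperplane[of "dual_normal e"] assms by (simp add: lor_eq_inner)

lemma lor_orth_subset_imp_multiple:
  assumes e: "lor e e = 1" and sub: "{x. lor x e = 0} \<subseteq> {x. lor x f = 0}"
  shows "f = lor f e *\<^sub>R e"
proof -
  have "lor x (f - lor f e *\<^sub>R e) = 0" for x
  proof -
    have "lor (x - lor x e *\<^sub>R e) e = 0" by (simp add: lor_algebra e)
    then have "lor (x - lor x e *\<^sub>R e) f = 0" using sub by blast
    then show ?thesis by (simp add: lor_algebra lor_commute[of e f])
  qed
  then show ?thesis using lor_nondegenerate by fastforce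
qed

lemma unit_lor_orth_subset_imp_eq:
  assumes e: "lor e e = 1" and f: "lor f f = 1" and sub: "{x. lor x e = 0} \<subseteq> {x. lor x f = 0}"
    and p: "lor p e < 0" "lor p f < 0"
  shows "f = e"
proof -
  define c where "c = lor f e"
  have fe: "f = c *\<^sub>R e" using lor_orth_subset_imp_multiple[OF e sub] by (simp add: c_def)
  then have "c * c = 1" using e f by (simp add: lor_algebra)
  moreover have "c * lor p e < 0" using p(2) by (simp add: fe lor_algebra)
  then have "c > 0" using p(1) by (simp add: mult_less_0_iff)
  ultimately have "c = 1" by (simp add: square_eq_1_iff)
  then show ?thesis using fe by simp
qed

text \<open>
  The point \<open>Rep_hyp v + s *\<^sub>R x\<close> stays timelike and future-directed for small \<open>s\<close>, so it
  can be rescaled to a point of hyperbolic space, which tends to \<open>v\<close>.  Linear conditions on \<open>x\<close>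
  are thereby transferred to points of hyperbolic space near \<open>v\<close>.
\<close>

lemma eventually_hyp_ray:
  fixes v :: "'a::euclidean_space hyp"
  assumes "r > 0"
  shows "\<forall>\<^sub>F s in at_right 0. \<exists>q c. c > 0 \<and> Rep_hyp q = c *\<^sub>R (Rep_hyp v + s *\<^sub>R x) \<and> dist v q < r"
proof -
  let ?y = "\<lambda>s. Rep_hyp v + s *\<^sub>R x"
  define D where "D s = - lor (?y s) (?y s)" for s
  have D: "D s = 1 - 2 * s * lor (Rep_hyp v) x - s * s * lor x x" for s
    by (simp add: D_def lor_algebra lor_Rep_hyp lor_commute[of x "Rep_hyp v"] algebra_simps)
  have l1: "(D \<longlongrightarrow> 1) (at_right 0)"
    unfolding D by (auto intro!: tendsto_eq_intros)
  have l2: "((\<lambda>s. snd (?y s)) \<longlongrightarrow> snd (Rep_hyp v)) (at_right 0)"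
    by (auto intro!: tendsto_eq_intros)
  have l3: "((\<lambda>s. (1 - s * lor (Rep_hyp v) x) / sqrt (D s)) \<longlongrightarrow> 1) (at_right 0)"
    using l1 by (auto intro!: tendsto_eq_intros)
  have "1 < cosh r" using assms cosh_real_nonneg_less_iff[of 0 r] by simp
  with l3 have e3: "\<forall>\<^sub>F s in at_right 0. (1 - s * lor (Rep_hyp v) x) / sqrt (D s) < cosh r"
    by (rule order_tendstoD)
  have e1: "\<forall>\<^sub>F s in at_right 0. D s > 0" using l1 by (rule order_tendstoD) simp
  have e2: "\<forall>\<^sub>F s in at_right 0. snd (?y s) > 0"
    using l2 by (rule order_tendstoD) (rule snd_Rep_hyp)
  from e1 e2 e3 show ?thesis
  proof eventually_elim
    case (elim s)
    define c where "c = 1 / sqrt (D s)"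
    have c: "c > 0" using elim(1) by (simp add: c_def)
    have cc: "c * c * D s = 1" using elim(1) by (simp add: c_def)
    have "lor (c *\<^sub>R ?y s) (c *\<^sub>R ?y s) = - (c * c * D s)"
      unfolding D_def by (simp only: lor_algebra(5,6))
    then have "c *\<^sub>R ?y s \<in> {p. lor p p = -1 \<and> snd p > 0}"
      using c elim(2) by (simp add: cc)
    then have "Rep_hyp (Abs_hyp (c *\<^sub>R ?y s)) = c *\<^sub>R ?y s" by (rule Abs_hyp_inverse)
    then obtain q where Rep: "Rep_hyp q = c *\<^sub>R ?y s" by blast
    have "- lor (Rep_hyp v) (Rep_hyp q) = c * (1 - s * lor (Rep_hyp v) x)"
      by (simp add: Rep lor_algebra lor_Rep_hyp algebra_simps)
    also have "\<dots> = (1 - s * lor (Rep_hyp v) x) / sqrt (D s)" by (simp add: c_def)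
    finally have "cosh (arcosh (- lor (Rep_hyp v) (Rep_hyp q))) < cosh r"
      using elim(3) lor_Rep_hyp_le[of v q] by simp
    then have "dist v q < r"
      using assms lor_Rep_hyp_le[of v q] unfolding dist_hyp_def
      by (subst (asm) cosh_real_nonneg_less_iff) auto
    then show ?case using c Rep by blast
  qed
qed

text \<open>
  Farkas' lemma: a finitely generated convex cone is closed, so a vector outside it is separated
  from it by a hyperplane.
\<close>

lemma farkas:
  fixes b :: "'a::euclidean_space \<times> real"
  assumes A: "finite A" and imp: "\<And>y. lor y e = 0 \<Longrightarrow> \<forall>g\<in>A. lor y g \<le> 0 \<Longrightarrow> lor y b \<le> 0"
  obtains m l where "\<forall>g\<in>A. 0 \<le> l g" "b = m *\<^sub>R e + (\<Sum>g\<in>A. l g *\<^sub>R g)"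
proof -
  let ?S = "insert e (insert (- e) A)" and ?H = "convex_cone hull insert e (insert (- e) A)"
  let ?C = "{m *\<^sub>R e + (\<Sum>g\<in>A. l g *\<^sub>R g) | m l. \<forall>g\<in>A. 0 \<le> (l g :: real)}"
  have inC: "m *\<^sub>R e + (\<Sum>g\<in>A. l g *\<^sub>R g) \<in> ?C" if "\<forall>g\<in>A. 0 \<le> l g" for m l
    using that by blast
  have "b \<in> ?H"
  proof (rule ccontr)
    assume "b \<notin> ?H"
    then obtain a \<beta> where ab: "a \<bullet> b < \<beta>" "\<And>x. x \<in> ?H \<Longrightarrow> \<beta> < a \<bullet> x"
      using separating_hyperplane_closed_point[of ?H b] A
      by (auto simp: closed_convex_cone_hull convex_convex_cone_hull)
    have \<beta>: "\<beta> < 0" using ab(2)[OF convex_cone_hull_contains_0] by simp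
    have pos: "0 \<le> a \<bullet> x" if x: "x \<in> ?H" for x
    proof (rule ccontr)
      assume neg: "\<not> 0 \<le> a \<bullet> x"
      then have "\<beta> < a \<bullet> ((\<beta> / (a \<bullet> x)) *\<^sub>R x)"
        using \<beta> by (intro ab(2) convex_cone_hull_mul[OF x]) (simp add: divide_nonpos_neg)
      then show False using neg by simp
    qed
    define y where "y = - dual_normal a"
    have y: "lor y x = - (a \<bullet> x)" for x
      by (simp add: y_def lor_def dual_normal_def inner_prod_def)
    have "a \<bullet> e = 0" using pos[of e] pos[of "- e"] by (simp add: hull_inc)
    moreover have "\<forall>g\<in>A. lor y g \<le> 0" using pos by (simp add: y hull_inc)
    ultimately show False using imp[of y] ab(1) \<beta> by (simp add: y)
  qed
  moreover have "?H \<subseteq> ?C"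
  proof (rule hull_minimal)
    show "?S \<subseteq> ?C"
    proof
      fix x assume "x \<in> ?S"
      then consider "x = e" | "x = - e" | "x \<in> A" by auto
      then show "x \<in> ?C"
      proof cases
        case 1 then show ?thesis using inC[of "\<lambda>_. 0" 1] by simp
      next
        case 2 then show ?thesis using inC[of "\<lambda>_. 0" "-1"] by simp
      next
        case 3
        have "(\<Sum>g\<in>A. (if g = x then 1 else 0) *\<^sub>R g) = (\<Sum>g\<in>A. if g = x then g else 0)"
          by (rule sum.cong) auto
        also have "\<dots> = x" using A 3 by (simp add: sum.delta)
        finally show ?thesis using inC[of "\<lambda>g. if g = x then 1 else 0" 0] by simp
      qed
    qed
    show "convex_cone ?C"
      unfolding convex_cone_iff
    proof (intro conjI ballI allI impI)
      show "0 \<in> ?C" using inC[of "\<lambda>_. 0" 0] by simp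
    next
      fix x y assume "x \<in> ?C" "y \<in> ?C"
      then obtain m l m' l' where "x = m *\<^sub>R e + (\<Sum>g\<in>A. l g *\<^sub>R g)" "\<forall>g\<in>A. 0 \<le> l g"
        "y = m' *\<^sub>R e + (\<Sum>g\<in>A. l' g *\<^sub>R g)" "\<forall>g\<in>A. 0 \<le> l' g" by blast
      then show "x + y \<in> ?C" using inC[of "\<lambda>g. l g + l' g" "m + m'"]
        by (simp add: algebra_simps sum.distrib)
    next
      fix x and c :: real assume "x \<in> ?C" "0 \<le> c"
      then obtain m l where "x = m *\<^sub>R e + (\<Sum>g\<in>A. l g *\<^sub>R g)" "\<forall>g\<in>A. 0 \<le> l g" by blast
      then show "c *\<^sub>R x \<in> ?C" using inC[of "\<lambda>g. c * l g" "c * m"] \<open>0 \<le> c\<close>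
        by (simp add: algebra_simps scaleR_sum_right)
    qed
  qed
  ultimately show thesis using that by blast
qed

text \<open>
  Among the points of the segment from \<open>q\<close> to \<open>y\<close> that lie in \<open>M\<close> there is a last one.
\<close>

lemma escape_through_rel_frontier:
  fixes M :: "'b::euclidean_space set"
  assumes "closed M" "q \<in> rel_interior M" "y \<in> affine hull M" "y \<notin> M"
  obtains u where "0 \<le> u" "u < 1" "q + u *\<^sub>R (y - q) \<in> M - rel_interior M"
proof -
  let ?f = "\<lambda>u. q + u *\<^sub>R (y - q)"
  let ?U = "{0..1} \<inter> ?f -` M"
  have q: "q \<in> M" using assms(2) rel_interior_subset by blast
  have "closed ?U" using assms(1) by (intro closed_Int closed_vimage continuous_intros) auto
  moreover have "bounded ?U" by (rule bounded_subset[of "{0..1}"]) auto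
  ultimately have "compact ?U" by (simp add: compact_eq_bounded_closed)
  moreover have "?U \<noteq> {}" using q by force
  ultimately have "\<exists>u\<in>?U. \<forall>w\<in>?U. w \<le> u" by (rule compact_attains_sup)
  then obtain u where u: "u \<in> ?U" and max: "\<And>w. w \<in> ?U \<Longrightarrow> w \<le> u" by blast
  have "u \<noteq> 1" using u assms(4) by auto
  with u have u1: "0 \<le> u" "u < 1" "?f u \<in> M" by auto
  have "?f u \<notin> rel_interior M"
  proof
    assume "?f u \<in> rel_interior M"
    then obtain r where r: "r > 0" "ball (?f u) r \<inter> affine hull M \<subseteq> M"
      by (auto simp: mem_rel_interior_ball)
    \<comment> \<open>A step along the segment that stays within the segment and within the ball of radius \<open>r\<close>.\<close>
    define d where "d = min (1 - u) (r / (2 * (norm (y - q) + 1)))"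
    have n: "norm (y - q) + 1 > 0" by (smt (verit) norm_ge_zero)
    have d: "d > 0" using u1(2) r(1) n by (simp add: d_def)
    have "d * norm (y - q) \<le> r / (2 * (norm (y - q) + 1)) * norm (y - q)"
      by (intro mult_right_mono) (auto simp: d_def)
    also have "\<dots> < r" using n r(1) by (simp add: divide_simps)
    finally have "dist (?f u) (?f (u + d)) < r"
      using d by (simp add: dist_norm algebra_simps flip: scaleR_diff_right)
    moreover have "?f (u + d) \<in> affine hull M"
    proof -
      have "(1 - (u + d)) *\<^sub>R q + (u + d) *\<^sub>R y \<in> affine hull M"
        using assms(3) hull_inc[OF q] affine_affine_hull[of M] by (intro mem_affine) auto
      then show ?thesis by (simp add: algebra_simps)
    qed
    ultimately have "?f (u + d) \<in> M" using r(2) by (auto simp: dist_commute)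
    then have "u + d \<in> ?U" using u1 d by (auto simp: d_def)
    then show False using max[of "u + d"] d by simp
  qed
  then show thesis using that u1 by blast
qed

lemma dim_lor_orth2:
  fixes e :: "'b::euclidean_space \<times> real"
  assumes "e \<noteq> 0" "\<not> {x. lor x e = 0} \<subseteq> {x. lor x g = 0}"
  shows "dim {x. lor x e = 0 \<and> lor x g = 0} < DIM('b)"
proof -
  have "{x. lor x e = 0 \<and> lor x g = 0} \<subset> {x. lor x e = 0}" using assms(2) by blast
  moreover have "span {x. lor x e = 0 \<and> lor x g = 0} = {x. lor x e = 0 \<and> lor x g = 0}"
    unfolding span_eq_iff by (auto simp: subspace_def lor_algebra)
  moreover have "span {x. lor x e = 0} = {x. lor x e = 0}"
    unfolding span_eq_iff by (rule subspace_lor_orth)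
  ultimately have "dim {x. lor x e = 0 \<and> lor x g = 0} < dim {x. lor x e = 0}"
    by (intro dim_psubset) (simp only:)
  then show ?thesis by (simp only: dim_lor_orth[OF assms(1)])
qed

section \<open>Walls and local cones of a polyhedron\<close>

text \<open>
  The outward unit normals of the walls.  Walls are handled through their normals from here on,
  because the hypotheses and conclusions about two walls are statements about the Lorentz
  product of the normals.
\<close>

definition normals :: "'a::euclidean_space hyp set \<Rightarrow> ('a \<times> real) set" where
  "normals Q = {e. lor e e = 1 \<and> Q \<subseteq> halfspace e \<and> hcodim (Q \<inter> hyperplane e) = 1}"

lemma normals_iff_outward_normal:
  "e \<in> normals Q \<longleftrightarrow> outward_normal Q (Q \<inter> hyperplane e) e \<and> wall Q (Q \<inter> hyperplane e)"
  unfolding normals_def wall_def outward_normal_def by blast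

text \<open>
  The half-spaces of \<open>E\<close> need not correspond to walls, as some of them may be redundant.
\<close>

locale polyhedron_with_interior =
  fixes Q :: "'a::euclidean_space hyp set" and E :: "('a \<times> real) set" and p :: "'a hyp"
  assumes unit: "e \<in> E \<Longrightarrow> lor e e = 1"
    and Q_eq: "Q = (\<Inter>e\<in>E. halfspace e)"
    and locally_finite: "\<exists>r>0. finite {e\<in>E. hyperplane e \<inter> ball x r \<noteq> {}}"
    and p_interior: "p \<in> interior Q"
begin

lemma lor_le_0: "q \<in> Q \<Longrightarrow> e \<in> E \<Longrightarrow> lor (Rep_hyp q) e \<le> 0"
  by (auto simp: Q_eq halfspace_def)

lemma Q_subset_halfspace: "e \<in> E \<Longrightarrow> Q \<subseteq> halfspace e"
  by (auto simp: halfspace_def lor_le_0)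

lemma normals_lor_le_0: "q \<in> Q \<Longrightarrow> e \<in> normals Q \<Longrightarrow> lor (Rep_hyp q) e \<le> 0"
  by (auto simp: normals_def halfspace_def)

lemma normals_unit: "e \<in> normals Q \<Longrightarrow> lor e e = 1"
  by (simp add: normals_def)

lemma p_strict:
  assumes e: "lor e e = 1" and Q: "Q \<subseteq> halfspace e"
  shows "lor (Rep_hyp p) e < 0"
proof (rule ccontr)
  assume "\<not> ?thesis"
  then have p0: "lor (Rep_hyp p) e \<ge> 0" by simp
  obtain r where r: "r > 0" "ball p r \<subseteq> Q" using p_interior by (meson mem_interior)
  have "\<forall>\<^sub>F s in at_right 0. \<exists>q c. c > 0 \<and> Rep_hyp q = c *\<^sub>R (Rep_hyp p + s *\<^sub>R e) \<and> dist p q < r"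
    by (rule eventually_hyp_ray[OF r(1)])
  moreover have "\<forall>\<^sub>F s in at_right 0. s > (0::real)" by (simp add: eventually_at_right_less)
  ultimately have "\<forall>\<^sub>F s in at_right (0::real). False"
  proof eventually_elim
    case (elim s)
    then obtain q c where q: "c > 0" "Rep_hyp q = c *\<^sub>R (Rep_hyp p + s *\<^sub>R e)" "dist p q < r" by blast
    then have "q \<in> halfspace e" using r Q by (auto simp: subset_eq)
    then have "c * (lor (Rep_hyp p) e + s) \<le> 0" by (simp add: halfspace_def q lor_algebra e)
    then show ?case using q(1) elim(2) p0 by (simp add: mult_le_0_iff)
  qed
  then show False by simp
qed

lemma p_strict_normals: "e \<in> normals Q \<Longrightarrow> lor (Rep_hyp p) e < 0"
  using p_strict by (simp add: normals_def)

text \<open>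
  This is what codimension one of a wall is used for: a wall determines its hyperplane.
\<close>

lemma span_face:
  assumes "e \<in> normals Q"
  shows "span (Rep_hyp ` (Q \<inter> hyperplane e)) = {x. lor x e = 0}"
proof (rule subspace_dim_equal)
  have "e \<noteq> 0" using normals_unit[OF assms] by auto
  then have "dim {x. lor x e = 0} = DIM('a)" by (rule dim_lor_orth)
  moreover have "dim (Rep_hyp ` (Q \<inter> hyperplane e)) = DIM('a)"
    using assms unfolding normals_def hcodim_def by simp linarith
  ultimately show "dim (span (Rep_hyp ` (Q \<inter> hyperplane e))) \<ge> dim {x. lor x e = 0}" by simp
  show "span (Rep_hyp ` (Q \<inter> hyperplane e)) \<subseteq> {x. lor x e = 0}"
    by (rule span_minimal) (auto simp: hyperplane_def subspace_lor_orth)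
qed (simp_all add: subspace_lor_orth)

lemma face_nonempty:
  assumes "e \<in> normals Q" shows "Q \<inter> hyperplane e \<noteq> {}"
proof
  assume "Q \<inter> hyperplane e = {}"
  then show False using assms by (simp add: normals_def hcodim_def)
qed

lemma normals_eqI:
  assumes e: "e \<in> normals Q" and f: "lor f f = 1" "Q \<subseteq> halfspace f"
    and sub: "Q \<inter> hyperplane e \<subseteq> hyperplane f"
  shows "f = e"
proof (rule unit_lor_orth_subset_imp_eq)
  have "span (Rep_hyp ` (Q \<inter> hyperplane e)) \<subseteq> {x. lor x f = 0}"
    using sub by (intro span_minimal subspace_lor_orth) (auto simp: hyperplane_def)
  then show "{x. lor x e = 0} \<subseteq> {x. lor x f = 0}" by (simp add: span_face[OF e])
qed (use e f p_strict[OF f] in \<open>auto simp: normals_unit p_strict_normals\<close>)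

lemma outward_normal_imp_normals:
  assumes "wall Q F" "outward_normal Q F e"
  shows "e \<in> normals Q" "F = Q \<inter> hyperplane e" "wall_normal Q F = e"
proof -
  show 1: "e \<in> normals Q" "F = Q \<inter> hyperplane e"
    using assms by (auto simp: normals_def outward_normal_def wall_def)
  show "wall_normal Q F = e"
    unfolding wall_normal_def using assms(2)
    by (rule the_equality) (rule normals_eqI[OF 1(1)], auto simp: outward_normal_def 1(2))
qed

lemma wall_iff: "wall Q F \<longleftrightarrow> (\<exists>e\<in>normals Q. F = Q \<inter> hyperplane e)"
proof
  assume "wall Q F"
  moreover from this obtain e where "outward_normal Q F e" unfolding wall_def by blast
  ultimately show "\<exists>e\<in>normals Q. F = Q \<inter> hyperplane e"
    using outward_normal_imp_normals by blast
qed (use normals_iff_outward_normal in blast)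

lemma wall_normal_face:
  assumes "e \<in> normals Q" shows "wall_normal Q (Q \<inter> hyperplane e) = e"
  using assms outward_normal_imp_normals(3) normals_iff_outward_normal by blast

text \<open>
  The cone cut out by the half-spaces whose boundary contains \<open>v\<close>.  It agrees with the cone over
  \<open>Q\<close> near \<open>v\<close>, and being an intersection of finitely many half-spaces it is a Euclidean
  polyhedron.
\<close>

definition local_cone :: "'a hyp \<Rightarrow> ('a \<times> real) set" where
  "local_cone v = {x. \<forall>e\<in>E. lor (Rep_hyp v) e = 0 \<longrightarrow> lor x e \<le> 0}"

lemma Rep_in_local_cone: "q \<in> Q \<Longrightarrow> Rep_hyp q \<in> local_cone v"
  by (simp add: local_cone_def lor_le_0)

text \<open>
  Only finitely many of the bounding hyperplanes come close to \<open>v\<close>.  Those through \<open>v\<close> are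
  respected by the definition of the local cone, the other ones of this finite set by
  continuity, and a hyperplane that stays away from a ball around \<open>v\<close> cannot be crossed inside
  that ball.
\<close>

lemma eventually_in_Q:
  assumes v: "v \<in> Q" and x: "x \<in> local_cone v"
  shows "\<forall>\<^sub>F s in at_right 0. \<exists>q\<in>Q. \<exists>c>0. Rep_hyp q = c *\<^sub>R (Rep_hyp v + s *\<^sub>R x)"
proof -
  let ?y = "\<lambda>s. Rep_hyp v + s *\<^sub>R x"
  obtain r where r: "r > 0" and fin: "finite {e\<in>E. hyperplane e \<inter> ball v r \<noteq> {}}"
    using locally_finite by blast
  obtain b where b: "b > 0"
    "\<And>s. s > 0 \<Longrightarrow> s < b \<Longrightarrow> \<exists>q c. c > 0 \<and> Rep_hyp q = c *\<^sub>R ?y s \<and> dist v q < r"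
    using eventually_hyp_ray[OF r, of v x] unfolding eventually_at_right_field by auto
  have "\<forall>\<^sub>F s in at_right 0. lor (?y s) e \<le> 0" if e: "e \<in> E" for e
  proof (cases "lor (Rep_hyp v) e = 0")
    case True
    then have le: "lor x e \<le> 0" using x e by (simp add: local_cone_def)
    show ?thesis
      using eventually_at_right_less[of "0::real"]
      by eventually_elim (simp add: lor_algebra True le mult_nonneg_nonpos)
  next
    case False
    then have "lor (Rep_hyp v) e < 0" using lor_le_0[OF v e] by simp
    moreover have "((\<lambda>s. lor (?y s) e) \<longlongrightarrow> lor (Rep_hyp v) e) (at_right 0)"
      unfolding lor_algebra by (auto intro!: tendsto_eq_intros)
    ultimately have "\<forall>\<^sub>F s in at_right 0. lor (?y s) e < 0" using order_tendstoD(2) by blast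
    then show ?thesis by eventually_elim simp
  qed
  then have "\<forall>\<^sub>F s in at_right 0. \<forall>e\<in>{e\<in>E. hyperplane e \<inter> ball v r \<noteq> {}}. lor (?y s) e \<le> 0"
    using fin by (intro eventually_ball_finite) auto
  moreover have "\<forall>\<^sub>F s in at_right (0::real). 0 < s \<and> s < b"
    using b(1) by (auto simp: eventually_at_right_field)
  ultimately show ?thesis
  proof eventually_elim
    case (elim s)
    have le: "lor (?y s) e \<le> 0" if e: "e \<in> E" for e
    proof (rule ccontr)
      assume pos: "\<not> lor (?y s) e \<le> 0"
      then have away: "hyperplane e \<inter> ball v r = {}" using elim(1) e by blast
      have "continuous_on {0..s} (\<lambda>u. lor (?y u) e)" by (intro continuous_intros)
      then obtain u where u: "0 \<le> u" "u \<le> s" "lor (?y u) e = 0"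
        using IVT'[of "\<lambda>u. lor (?y u) e" 0 0 s] lor_le_0[OF v e] pos elim(2) by auto
      show False
      proof (cases "u = 0")
        case True
        then have "v \<in> hyperplane e \<inter> ball v r" using u r by (simp add: hyperplane_def)
        then show False using away by blast
      next
        case False
        then obtain q c where q: "c > 0" "Rep_hyp q = c *\<^sub>R ?y u" "dist v q < r"
          using b(2)[of u] u elim(2) by auto
        then have "q \<in> hyperplane e \<inter> ball v r"
          using u(3) by (simp only: hyperplane_def lor_algebra(5) mem_Collect_eq IntI mem_ball mult_zero_right)
        then show False using away by blast
      qed
    qed
    obtain q c where q: "c > 0" "Rep_hyp q = c *\<^sub>R ?y s"
      using b(2)[of s] elim(2) by auto
    have "q \<in> Q" unfolding Q_eq halfspace_def
      using le q by (auto simp only: lor_algebra(5) mult_le_0_iff mem_Collect_eq INT_iff less_imp_le)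
    then show ?case using q by blast
  qed
qed

lemma local_coneE:
  assumes v: "v \<in> Q" and x: "x \<in> local_cone v"
  obtains s q c where "s > 0" "q \<in> Q" "c > 0" "Rep_hyp q = c *\<^sub>R (Rep_hyp v + s *\<^sub>R x)"
proof -
  have "\<forall>\<^sub>F s in at_right (0::real). s > 0 \<and> (\<exists>q\<in>Q. \<exists>c>0. Rep_hyp q = c *\<^sub>R (Rep_hyp v + s *\<^sub>R x))"
    using eventually_in_Q[OF v x] eventually_at_right_less by (rule eventually_elim2) blast
  then have "\<exists>s>0::real. \<exists>q\<in>Q. \<exists>c>0. Rep_hyp q = c *\<^sub>R (Rep_hyp v + s *\<^sub>R x)"
    by (rule eventually_happens'[rotated]) simp
  then show thesis using that by blast
qed

lemma local_cone_le:
  assumes v: "v \<in> Q" and x: "x \<in> local_cone v" and g: "Q \<subseteq> halfspace g" "lor (Rep_hyp v) g = 0"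
  shows "lor x g \<le> 0"
proof -
  obtain s q c where q: "s > 0" "q \<in> Q" "c > 0" "Rep_hyp q = c *\<^sub>R (Rep_hyp v + s *\<^sub>R x)"
    using local_coneE[OF v x] .
  then have "lor (Rep_hyp q) g \<le> 0" using g by (auto simp: halfspace_def)
  then show ?thesis using q by (simp add: lor_algebra g mult_le_0_iff)
qed

lemma local_cone_in_span:
  assumes v: "v \<in> Q" and x: "x \<in> local_cone v"
    and G: "\<And>g. g \<in> G \<Longrightarrow> lor (Rep_hyp v) g = 0" "\<And>g. g \<in> G \<Longrightarrow> lor x g = 0"
  shows "x \<in> span (Rep_hyp ` {q\<in>Q. \<forall>g\<in>G. lor (Rep_hyp q) g = 0})" (is "_ \<in> span ?R")
proof -
  obtain s q c where q: "s > 0" "q \<in> Q" "c > 0" "Rep_hyp q = c *\<^sub>R (Rep_hyp v + s *\<^sub>R x)"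
    using local_coneE[OF v x] .
  have "lor (Rep_hyp q) g = 0" if "g \<in> G" for g using G[OF that] q(4) by (simp add: lor_algebra)
  then have "Rep_hyp q \<in> ?R" using q(2) by blast
  moreover have "Rep_hyp v \<in> ?R" using v G(1) by blast
  ultimately have "(1 / s) *\<^sub>R ((1 / c) *\<^sub>R Rep_hyp q - Rep_hyp v) \<in> span ?R"
    by (intro span_mul span_diff span_base)
  moreover have "(1 / s) *\<^sub>R ((1 / c) *\<^sub>R Rep_hyp q - Rep_hyp v) = x" using q by simp
  ultimately show ?thesis by simp
qed

lemma local_cone_scale: "x \<in> local_cone v \<Longrightarrow> 0 \<le> c \<Longrightarrow> c *\<^sub>R x \<in> local_cone v"
  by (auto simp: local_cone_def lor_algebra mult_nonneg_nonpos)

lemma finite_active: "finite {e\<in>E. lor (Rep_hyp v) e = 0}"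
proof -
  obtain r where r: "r > 0" "finite {e\<in>E. hyperplane e \<inter> ball v r \<noteq> {}}" using locally_finite by blast
  have "{e\<in>E. lor (Rep_hyp v) e = 0} \<subseteq> {e\<in>E. hyperplane e \<inter> ball v r \<noteq> {}}"
  proof
    fix e assume e: "e \<in> {e\<in>E. lor (Rep_hyp v) e = 0}"
    then have "v \<in> hyperplane e \<inter> ball v r" using r by (simp add: hyperplane_def)
    then show "e \<in> {e\<in>E. hyperplane e \<inter> ball v r \<noteq> {}}" using e by blast
  qed
  then show ?thesis using r(2) by (rule finite_subset)
qed

lemma local_cone_eq_Inter:
  "local_cone v = (\<Inter>e\<in>{e\<in>E. lor (Rep_hyp v) e = 0}. {x. dual_normal e \<bullet> x \<le> 0})"
  by (auto simp: local_cone_def lor_eq_inner)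

lemma polyhedron_local_cone: "polyhedron (local_cone v)"
  unfolding local_cone_eq_Inter
proof (rule polyhedron_Inter)
  show "finite ((\<lambda>e. {x. dual_normal e \<bullet> x \<le> 0}) ` {e \<in> E. lor (Rep_hyp v) e = 0})"
    by (rule finite_imageI) (rule finite_active)
qed (auto simp: polyhedron_halfspace_le)

end

text \<open>
  Normal vectors are pairs.  Without the following declaration the simplifier rewrites bounded
  quantifiers over sets of normals to quantifiers over components, to which the facts about
  normals no longer apply.
\<close>

declare split_paired_All [simp del] split_paired_Ex [simp del]

context polyhedron_with_interior
begin

lemma aff_dim_local_cone: "aff_dim (local_cone v) = DIM('a) + 1"
proof -
  let ?U = "\<Inter>e\<in>{e\<in>E. lor (Rep_hyp v) e = 0}. {x. dual_normal e \<bullet> x < 0}"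
  have "open ?U" by (intro open_INT[OF finite_active] ballI open_halfspace_lt)
  moreover have "?U \<subseteq> local_cone v" 
  proof
    fix x assume "x \<in> ?U"
    then show "x \<in> local_cone v" unfolding local_cone_def by (simp add: lor_eq_inner less_imp_le)
  qed
  moreover have "lor (Rep_hyp p) e < 0" if "e \<in> E" for e
    by (rule p_strict[OF unit[OF that] Q_subset_halfspace[OF that]])
  then have "Rep_hyp p \<in> ?U" by (simp add: lor_eq_inner)
  ultimately have "Rep_hyp p \<in> interior (local_cone v)" by (intro interiorI)
  then have "interior (local_cone v) \<noteq> {}" by blast
  then show ?thesis by (simp add: aff_dim_nonempty_interior)
qed

text \<open>
  The facets of the local cone come from walls of \<open>Q\<close> through \<open>v\<close>.  The supporting hyperplane of
  a facet is linear, since the local cone is invariant under scaling, and contains \<open>v\<close>, since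
  the cone contains the line through \<open>v\<close>; so its normal is orthogonal to a timelike vector,
  hence spacelike, and can be normalised.
\<close>

lemma facet_normal:
  assumes v: "v \<in> Q" and c: "c facet_of local_cone v"
  obtains g where "g \<in> normals Q" "lor (Rep_hyp v) g = 0" "c = local_cone v \<inter> {x. lor x g = 0}"
proof -
  let ?K = "local_cone v"
  obtain a b where ab: "a \<noteq> 0" "?K \<subseteq> {x. a \<bullet> x \<le> b}" "c = ?K \<inter> {x. a \<bullet> x = b}"
    using facet_of_polyhedron[OF polyhedron_local_cone c] .
  have "c \<noteq> {}" using c by (simp add: facet_of_def)
  have "0 \<in> ?K" by (simp add: local_cone_def)
  then have "b \<ge> 0" using ab(2) by auto
  moreover obtain x where x: "x \<in> ?K" "a \<bullet> x = b" using \<open>c \<noteq> {}\<close> ab(3) by blast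
  then have "2 *\<^sub>R x \<in> ?K" by (intro local_cone_scale) auto
  then have "2 * b \<le> b" using ab(2) x(2) by auto
  ultimately have b: "b = 0" by simp
  define h where "h = dual_normal a"
  have h: "lor x h = a \<bullet> x" for x by (simp add: h_def lor_def dual_normal_def inner_prod_def inner_commute)
  have h0: "h \<noteq> 0" using ab(1) by (simp add: h_def)
  have "Rep_hyp v \<in> ?K" "- Rep_hyp v \<in> ?K" by (auto simp: local_cone_def)
  then have "a \<bullet> Rep_hyp v \<le> 0" "a \<bullet> (- Rep_hyp v) \<le> 0" using ab(2) b by blast+
  then have hv: "lor (Rep_hyp v) h = 0" by (simp add: h)
  then have hv': "lor h (Rep_hyp v) = 0" by (simp only: lor_commute[of h])
  have "lor h h \<noteq> 0" using lor_orth_eq_0[OF lor_Rep_hyp hv'] h0 by metis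
  moreover have "lor h h \<ge> 0" by (rule lor_orth_nonneg[OF lor_Rep_hyp hv'])
  ultimately have hh: "lor h h > 0" by simp
  define g where "g = (1 / sqrt (lor h h)) *\<^sub>R h"
  have g: "lor x g = (a \<bullet> x) / sqrt (lor h h)" for x by (simp add: g_def lor_algebra h)
  have gg: "lor g g = 1" using hh by (simp add: g_def lor_algebra)
  have gK: "lor x g \<le> 0" if "x \<in> ?K" for x using that ab(2) b hh by (auto simp: g divide_nonpos_pos)
  have c_eq: "c = ?K \<inter> {x. lor x g = 0}" using ab(3) b hh by (auto simp: g)
  have gv: "lor (Rep_hyp v) g = 0" using hv by (simp add: g_def lor_algebra)
  have Qg: "Q \<subseteq> halfspace g"
    unfolding halfspace_def using gK[OF Rep_in_local_cone] by blast
  have "c \<subseteq> span (Rep_hyp ` (Q \<inter> hyperplane g))"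
  proof
    fix x assume "x \<in> c"
    then have "x \<in> ?K" "lor x g = 0" unfolding c_eq by blast+
    then have "x \<in> span (Rep_hyp ` {q\<in>Q. \<forall>g\<in>{g}. lor (Rep_hyp q) g = 0})"
      using local_cone_in_span[OF v, of x "{g}"] gv by simp
    moreover have "{q\<in>Q. \<forall>g\<in>{g}. lor (Rep_hyp q) g = 0} = Q \<inter> hyperplane g"
      by (simp add: hyperplane_def Collect_conj_eq)
    ultimately show "x \<in> span (Rep_hyp ` (Q \<inter> hyperplane g))" by simp
  qed
  then have "dim c \<le> dim (Rep_hyp ` (Q \<inter> hyperplane g))" by (metis dim_mono)
  moreover have "int (dim c) = DIM('a)"
  proof -
    have "0 \<in> c" using c_eq \<open>0 \<in> ?K\<close> by simp
    then show ?thesis using c aff_dim_zero[of c] by (simp add: facet_of_def aff_dim_local_cone hull_inc)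
  qed
  moreover have "dim (Rep_hyp ` (Q \<inter> hyperplane g)) \<le> dim {x. lor x g = 0}"
    by (intro dim_subset) (auto simp: hyperplane_def)
  moreover have "dim {x. lor x g = 0} = DIM('a)" using gg by (intro dim_lor_orth) auto
  ultimately have "hcodim (Q \<inter> hyperplane g) = 1" by (simp add: hcodim_def)
  then have "g \<in> normals Q" using gg Qg by (simp add: normals_def)
  then show thesis using that gv c_eq by blast
qed

text \<open>
  The walls through \<open>v\<close> that share a face of codimension two with the wall of \<open>e\<close>.  These are
  the walls whose angle with the wall of \<open>e\<close> is controlled by the definition of a Coxeter
  polyhedron.
\<close>

definition adjacent :: "'a hyp \<Rightarrow> 'a \<times> real \<Rightarrow> ('a \<times> real) set" where
  "adjacent v e = {g \<in> normals Q. g \<noteq> e \<and> lor (Rep_hyp v) g = 0 \<and>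
     hcodim (Q \<inter> hyperplane e \<inter> (Q \<inter> hyperplane g)) = 2}"

lemma facet_of_wall:
  assumes v: "v \<in> Q" and e: "e \<in> normals Q" "lor (Rep_hyp v) e = 0"
  defines "M \<equiv> local_cone v \<inter> {x. lor x e = 0}"
  shows "M face_of local_cone v" "span M = {x. lor x e = 0}" "affine hull M = {x. lor x e = 0}"
    "aff_dim M = DIM('a)"
proof -
  have le: "lor x e \<le> 0" if "x \<in> local_cone v" for x
    using that v e by (intro local_cone_le) (auto simp: normals_def)
  have "(local_cone v \<inter> {x. dual_normal e \<bullet> x = 0}) face_of local_cone v"
    using polyhedron_imp_convex[OF polyhedron_local_cone] le
    by (intro face_of_Int_supporting_hyperplane_le) (auto simp: lor_eq_inner)
  then show "M face_of local_cone v" by (simp add: M_def lor_eq_inner)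
  have "Rep_hyp ` (Q \<inter> hyperplane e) \<subseteq> M"
    using Rep_in_local_cone by (auto simp: M_def hyperplane_def)
  then have "{x. lor x e = 0} \<subseteq> span M" using span_mono span_face[OF e(1)] by metis
  moreover have "span M \<subseteq> {x. lor x e = 0}"
    by (rule span_minimal) (auto simp: M_def subspace_lor_orth)
  ultimately show sp: "span M = {x. lor x e = 0}" by blast
  have "0 \<in> M" by (simp add: M_def local_cone_def)
  then show "affine hull M = {x. lor x e = 0}" using sp by (simp add: affine_hull_span_0 hull_inc)
  have "e \<noteq> 0" using normals_unit[OF e(1)] by auto
  then show "aff_dim M = DIM('a)"
    using aff_dim_zero[of M] \<open>0 \<in> M\<close> sp dim_lor_orth[of e] dim_span[of M] by (simp add: hull_inc)
qed

text \<open>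
  A facet \<open>R\<close> of a facet of the local cone is the intersection of the facets that contain it, so
  it lies in a second facet.  The two corresponding walls intersect in codimension two, because
  their intersection spans a space that contains \<open>R\<close>.
\<close>

lemma ridge_normal:
  assumes v: "v \<in> Q" and e: "e \<in> normals Q" "lor (Rep_hyp v) e = 0"
    and R: "R facet_of local_cone v \<inter> {x. lor x e = 0}"
  obtains c g where "c facet_of local_cone v" "g \<in> adjacent v e"
    "c = local_cone v \<inter> {x. lor x g = 0}" "R \<subseteq> c"
proof -
  let ?K = "local_cone v" and ?M = "local_cone v \<inter> {x. lor x e = 0}"
  note M = facet_of_wall[OF v e]
  have RM: "R face_of ?M" "R \<noteq> {}" "aff_dim R = DIM('a) - 1"
    using R M(4) by (auto simp: facet_of_def)
  have RK: "R face_of ?K" using face_of_trans[OF RM(1) M(1)] .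
  have "R \<noteq> ?K" using RM(3) aff_dim_local_cone[of v] by auto
  then have R_eq: "R = \<Inter>{c. c facet_of ?K \<and> R \<subseteq> c}"
    using face_of_polyhedron[OF polyhedron_local_cone RK RM(2)] by blast
  have "\<exists>c. c facet_of ?K \<and> R \<subseteq> c \<and> c \<noteq> ?M"
  proof (rule ccontr)
    assume "\<not> ?thesis"
    then have "?M \<subseteq> \<Inter>{c. c facet_of ?K \<and> R \<subseteq> c}" by blast
    then have "?M = R" using R_eq facet_of_imp_subset[OF R] by blast
    then show False using R facet_of_irrefl by metis
  qed
  then obtain c where c: "c facet_of ?K" "R \<subseteq> c" "c \<noteq> ?M" by blast
  obtain g where g: "g \<in> normals Q" "lor (Rep_hyp v) g = 0" "c = ?K \<inter> {x. lor x g = 0}"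
    using facet_normal[OF v c(1)] .
  have ge: "g \<noteq> e" using c(3) g(3) by blast
  let ?R = "Rep_hyp ` (Q \<inter> hyperplane e \<inter> (Q \<inter> hyperplane g))"
  have "R \<subseteq> span ?R"
  proof
    fix x assume "x \<in> R"
    then have "x \<in> ?K" "lor x e = 0" "lor x g = 0"
      using c(2) g(3) face_of_imp_subset[OF RM(1)] by blast+
    then have "x \<in> span (Rep_hyp ` {q\<in>Q. \<forall>g\<in>{e, g}. lor (Rep_hyp q) g = 0})"
      using local_cone_in_span[OF v, of x "{e, g}"] g(2) e(2) by blast
    moreover have "{q\<in>Q. \<forall>g\<in>{e, g}. lor (Rep_hyp q) g = 0} = Q \<inter> hyperplane e \<inter> (Q \<inter> hyperplane g)"
      by (auto simp: hyperplane_def)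
    ultimately show "x \<in> span ?R" by simp
  qed
  then have "dim R \<le> dim ?R" by (metis dim_mono)
  moreover have "int (dim R) = int DIM('a) - 1"
  proof -
    \<comment> \<open>The face \<open>R\<close> of a cone contains the apex, so its dimension is that of its span.\<close>
    have "0 \<in> R"
    proof -
      have "0 \<in> ?M" by (simp add: local_cone_def)
      obtain x where x: "x \<in> R" using RM(2) by blast
      then have xM: "x \<in> ?M" using face_of_imp_subset[OF RM(1)] by blast
      then have "2 *\<^sub>R x \<in> ?M" using local_cone_scale[of x v 2] by (simp add: lor_algebra)
      show ?thesis
      proof (cases "x = 0")
        case False
        have "x = (1 / 2) *\<^sub>R 0 + (1 / 2) *\<^sub>R (2 *\<^sub>R x)" by simp
        then have "x \<in> open_segment 0 (2 *\<^sub>R x)"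
          using False by (auto simp: in_segment intro!: exI[of _ "1/2"])
        then show ?thesis using RM(1) x \<open>0 \<in> ?M\<close> \<open>2 *\<^sub>R x \<in> ?M\<close> unfolding face_of_def by blast
      qed (use x in simp)
    qed
    then show ?thesis using aff_dim_zero[of R] RM(3) by (simp add: hull_inc)
  qed
  moreover have "dim ?R < DIM('a)"
  proof -
    have "\<not> {x. lor x e = 0} \<subseteq> {x. lor x g = 0}"
      using unit_lor_orth_subset_imp_eq[OF normals_unit[OF e(1)] normals_unit[OF g(1)]]
        p_strict_normals[OF e(1)] p_strict_normals[OF g(1)] ge by blast
    moreover have "e \<noteq> 0" using normals_unit[OF e(1)] by auto
    ultimately have "dim {x. lor x e = 0 \<and> lor x g = 0} < DIM('a)" by (intro dim_lor_orth2)
    moreover have "dim ?R \<le> dim {x. lor x e = 0 \<and> lor x g = 0}"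
      by (intro dim_subset) (auto simp: hyperplane_def)
    ultimately show ?thesis by simp
  qed
  ultimately have "hcodim (Q \<inter> hyperplane e \<inter> (Q \<inter> hyperplane g)) = 2"
    by (simp add: hcodim_def)
  then have "g \<in> adjacent v e" using g ge by (simp add: adjacent_def)
  then show thesis using that c g by blast
qed

text \<open>
  Within its hyperplane, the local cone of a wall is cut out by the adjacent walls alone: a
  segment that leaves it does so through one of its facets, which lies in an adjacent wall by
  \<open>ridge_normal\<close>.
\<close>

lemma wall_cone_cut_out_by_adjacent:
  assumes v: "v \<in> Q" and e: "e \<in> normals Q" "lor (Rep_hyp v) e = 0"
  obtains A where "finite A" "A \<subseteq> adjacent v e"
    "\<And>y. lor y e = 0 \<Longrightarrow> \<forall>g\<in>A. lor y g \<le> 0 \<Longrightarrow> y \<in> local_cone v"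
proof -
  let ?K = "local_cone v" and ?M = "local_cone v \<inter> {x. lor x e = 0}"
  note M = facet_of_wall[OF v e]
  have polyM: "polyhedron ?M" using face_of_polyhedron_polyhedron[OF polyhedron_local_cone M(1)] .
  define nrm where "nrm c = (SOME g. g \<in> adjacent v e \<and> c = ?K \<inter> {x. lor x g = 0})" for c
  define A where "A = nrm ` {c. c facet_of ?K} \<inter> adjacent v e"
  have "finite A" unfolding A_def using finite_polyhedron_facets[OF polyhedron_local_cone] by blast
  moreover have "A \<subseteq> adjacent v e" by (simp add: A_def)
  moreover have "y \<in> ?K" if y: "lor y e = 0" "\<forall>g\<in>A. lor y g \<le> 0" for y
  proof (rule ccontr)
    assume "y \<notin> ?K"
    have "0 \<in> ?M" by (simp add: local_cone_def)
    then obtain q where q: "q \<in> rel_interior ?M"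
      using rel_interior_eq_empty polyhedron_imp_convex[OF polyM] by blast
    have "y \<in> affine hull ?M" "y \<notin> ?M" using M(3) y(1) \<open>y \<notin> ?K\<close> by blast+
    then obtain u where u: "0 \<le> u" "u < 1" "q + u *\<^sub>R (y - q) \<in> ?M - rel_interior ?M"
      using escape_through_rel_frontier[OF polyhedron_imp_closed[OF polyM] q] by blast
    then obtain R where R: "R facet_of ?M" "q + u *\<^sub>R (y - q) \<in> R"
      using rel_boundary_of_polyhedron[OF polyM] by blast
    obtain c g where cg: "c facet_of ?K" "g \<in> adjacent v e" "c = ?K \<inter> {x. lor x g = 0}" "R \<subseteq> c"
      using ridge_normal[OF v e R(1)] .
    have n: "nrm c \<in> adjacent v e \<and> c = ?K \<inter> {x. lor x (nrm c) = 0}"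
      unfolding nrm_def
      by (rule someI[where x = g and P = "\<lambda>g. g \<in> adjacent v e \<and> c = ?K \<inter> {x. lor x g = 0}"])
        (use cg in blast)
    define h where "h = nrm c"
    have h: "h \<in> A" "h \<in> adjacent v e" "c = ?K \<inter> {x. lor x h = 0}"
      using n cg(1) by (auto simp: A_def h_def)
    have qM: "q \<in> ?M" using q rel_interior_subset by blast
    have hN: "h \<in> normals Q" "lor (Rep_hyp v) h = 0" "h \<noteq> e" using h(2) by (auto simp: adjacent_def)
    have "lor q h \<le> 0"
      using qM hN by (intro local_cone_le[OF v]) (auto simp: normals_def)
    moreover have "lor q h \<noteq> 0"
    proof
      assume "lor q h = 0"
      then have "c \<inter> rel_interior ?M \<noteq> {}" using h(3) q qM by blast
      then have "?M \<subseteq> c"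
        using subset_of_face_of[OF facet_of_imp_face_of[OF cg(1)]] by blast
      then have "?M \<subseteq> {x. lor x h = 0}" using h(3) by blast
      then have "span ?M \<subseteq> {x. lor x h = 0}" by (intro span_minimal subspace_lor_orth)
      then have "{x. lor x e = 0} \<subseteq> {x. lor x h = 0}" using M(2) by simp
      then show False
        using unit_lor_orth_subset_imp_eq[OF normals_unit[OF e(1)] normals_unit[OF hN(1)]]
          p_strict_normals[OF e(1)] p_strict_normals[OF hN(1)] hN(3) by blast
    qed
    ultimately have "(1 - u) * lor q h < 0" using u(2) by (simp add: mult_less_0_iff)
    moreover have "u * lor y h \<le> 0" using y(2) h(1) u(1) by (simp add: mult_nonneg_nonpos)
    moreover have "lor (q + u *\<^sub>R (y - q)) h = 0" using R(2) cg(4) h(3) by blast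
    ultimately show False by (simp add: lor_algebra algebra_simps)
  qed
  ultimately show thesis using that by blast
qed

text \<open>
  The source of all information on pairs of walls.  Only normals of adjacent walls occur in the
  combination, and these are the normals whose products with \<open>e\<close> have a known sign.
\<close>

lemma normal_combination:
  assumes v: "v \<in> Q" and e: "e \<in> normals Q" "lor (Rep_hyp v) e = 0"
    and b: "\<And>x. x \<in> local_cone v \<Longrightarrow> lor x e = 0 \<Longrightarrow> lor x b \<le> 0"
  obtains A m l where "finite A" "A \<subseteq> adjacent v e" "\<forall>g\<in>A. 0 \<le> l g"
    "b = m *\<^sub>R e + (\<Sum>g\<in>A. l g *\<^sub>R g)"
proof -
  obtain A where A: "finite A" "A \<subseteq> adjacent v e"
    "\<And>y. lor y e = 0 \<Longrightarrow> \<forall>g\<in>A. lor y g \<le> 0 \<Longrightarrow> y \<in> local_cone v"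
    using wall_cone_cut_out_by_adjacent[OF v e] by blast
  obtain l m where "\<forall>g\<in>A. 0 \<le> l g" "b = m *\<^sub>R e + (\<Sum>g\<in>A. l g *\<^sub>R g)"
    using farkas[OF A(1), of e b] b A(3) by blast
  then show thesis using that A by blast
qed

end

section \<open>Nonobtuse polyhedra\<close>

lemma lor_sum_right: "lor x (\<Sum>g\<in>A. h g) = (\<Sum>g\<in>A. lor x (h g))"
  by (induction A rule: infinite_finite_induct) (simp_all add: lor_algebra)

locale nonobtuse_polyhedron = polyhedron_with_interior Q E p
  for Q :: "'a::euclidean_space hyp set" and E p +
  assumes nonobtuse: "v \<in> Q \<Longrightarrow> e \<in> normals Q \<Longrightarrow> g \<in> adjacent v e \<Longrightarrow> lor (Rep_hyp v) e = 0 \<Longrightarrow> lor e g \<le> 0"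
begin

text \<open>
  Otherwise every product in the combination would vanish on the whole wall of \<open>f\<close>, so that a
  wall with positive coefficient would contain the wall of \<open>f\<close> and hence be equal to it.
\<close>

lemma wall_not_redundant:
  assumes f: "f \<in> normals Q" and A: "finite A" "A \<subseteq> normals Q" "f \<notin> A" and l: "\<forall>g\<in>A. 0 \<le> l g"
  shows "f \<noteq> (\<Sum>g\<in>A. l g *\<^sub>R g)"
proof
  assume f_eq: "f = (\<Sum>g\<in>A. l g *\<^sub>R g)"
  have "l g = 0" if g: "g \<in> A" for g
  proof (rule ccontr)
    assume "l g \<noteq> 0"
    have "lor (Rep_hyp y) g = 0" if y: "y \<in> Q" "lor (Rep_hyp y) f = 0" for y
    proof -
      have "(\<Sum>h\<in>A. l h * lor (Rep_hyp y) h) = lor (Rep_hyp y) f"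
        by (simp add: f_eq lor_sum_right lor_algebra)
      then have "(\<Sum>h\<in>A. - (l h * lor (Rep_hyp y) h)) = 0" using y(2) by (simp add: sum_negf)
      moreover have "0 \<le> - (l h * lor (Rep_hyp y) h)" if "h \<in> A" for h
      proof -
        have "0 \<le> l h" "h \<in> normals Q" using that l A(2) by blast+
        then show ?thesis using normals_lor_le_0[OF y(1)] by (simp add: mult_nonneg_nonpos)
      qed
      ultimately have "\<forall>h\<in>A. - (l h * lor (Rep_hyp y) h) = 0"
        using sum_nonneg_eq_0_iff[OF A(1), of "\<lambda>h. - (l h * lor (Rep_hyp y) h)"] by simp
      then have "l g * lor (Rep_hyp y) g = 0" using g by simp
      then show ?thesis using \<open>l g \<noteq> 0\<close> by simp
    qed
    then have "Q \<inter> hyperplane f \<subseteq> hyperplane g" by (auto simp: hyperplane_def)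
    moreover have "g \<in> normals Q" using g A(2) by blast
    then have "lor g g = 1" "Q \<subseteq> halfspace g" by (auto simp: normals_def)
    ultimately have "g = f" using normals_eqI[OF f] by blast
    then show False using g A(3) by blast
  qed
  then have "f = 0" using f_eq by simp
  then show False using normals_unit[OF f] by simp
qed

text \<open>
  The coefficient \<open>m\<close> is negative because otherwise \<open>f\<close> would be a nonnegative combination of
  normals of other walls.
\<close>

lemma wall_through_point_combination:
  assumes v: "v \<in> Q" and e: "e \<in> normals Q" "lor (Rep_hyp v) e = 0"
    and f: "f \<in> normals Q" "lor (Rep_hyp v) f = 0" and ne: "e \<noteq> f" and nadj: "f \<notin> adjacent v e"
  obtains A m l where "finite A" "A \<subseteq> adjacent v e" "\<forall>g\<in>A. 0 \<le> l g" "m < 0"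
    "f = m *\<^sub>R e + (\<Sum>g\<in>A. l g *\<^sub>R g)"
proof -
  have "lor x f \<le> 0" if "x \<in> local_cone v" "lor x e = 0" for x
    using local_cone_le[OF v that(1) _ f(2)] f(1) by (simp add: normals_def)
  note comb = normal_combination[OF v e this]
  obtain A m l where A: "finite A" "A \<subseteq> adjacent v e" "\<forall>g\<in>A. 0 \<le> l g"
    and f_eq: "f = m *\<^sub>R e + (\<Sum>g\<in>A. l g *\<^sub>R g)"
    using comb .
  have "m < 0"
  proof (rule ccontr)
    assume "\<not> m < 0"
    have eA: "e \<notin> A" using A(2) by (auto simp: adjacent_def)
    define l' where "l' = l(e := m)"
    have "(\<Sum>g\<in>A. l' g *\<^sub>R g) = (\<Sum>g\<in>A. l g *\<^sub>R g)"
      using eA by (intro sum.cong) (auto simp: l'_def)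
    then have "f = (\<Sum>g\<in>insert e A. l' g *\<^sub>R g)"
      using A(1) eA f_eq by (simp add: l'_def)
    moreover have "\<forall>g\<in>insert e A. 0 \<le> l' g" using A(3) \<open>\<not> m < 0\<close> by (simp add: l'_def)
    moreover have "insert e A \<subseteq> normals Q" using A(2) e(1) by (auto simp: adjacent_def)
    moreover have "f \<notin> insert e A" using ne nadj A(2) by blast
    ultimately show False using wall_not_redundant[OF f(1), of "insert e A" l'] A(1) by simp
  qed
  then show thesis by (rule that[OF A _ f_eq])
qed

lemma lor_adjacent_sum_le_0:
  assumes "A \<subseteq> adjacent v e" "\<forall>g\<in>A. 0 \<le> l g" "v \<in> Q" "e \<in> normals Q" "lor (Rep_hyp v) e = 0"
  shows "lor e (\<Sum>g\<in>A. l g *\<^sub>R g) \<le> 0"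
  unfolding lor_sum_right lor_algebra
proof (rule sum_nonpos)
  fix g assume "g \<in> A"
  then have "0 \<le> l g" "lor e g \<le> 0" using assms nonobtuse by blast+
  then show "l g * lor e g \<le> 0" by (rule mult_nonneg_nonpos)
qed

text \<open>
  If the walls are not adjacent, \<open>f\<close> is a negative multiple of \<open>e\<close> plus a combination of normals
  that have nonpositive products with \<open>e\<close>.
\<close>

lemma lor_le_0_if_meet:
  assumes v: "v \<in> Q" and e: "e \<in> normals Q" "lor (Rep_hyp v) e = 0"
    and f: "f \<in> normals Q" "lor (Rep_hyp v) f = 0" and ne: "e \<noteq> f"
  shows "lor e f \<le> 0"
proof (cases "f \<in> adjacent v e")
  case True
  then show ?thesis using nonobtuse v e by blast
next
  case False
  obtain A m l where A: "finite A" "A \<subseteq> adjacent v e" "\<forall>g\<in>A. 0 \<le> l g" "m < 0"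
    and f_eq: "f = m *\<^sub>R e + (\<Sum>g\<in>A. l g *\<^sub>R g)"
    using wall_through_point_combination[OF v e f ne False] .
  have "lor e f = m + lor e (\<Sum>g\<in>A. l g *\<^sub>R g)"
    unfolding f_eq by (simp add: lor_algebra normals_unit[OF e(1)])
  then show ?thesis using lor_adjacent_sum_le_0[OF A(2,3) v e] A(4) by simp
qed

text \<open>
  A nonobtuse polyhedron is simple: two walls with a common point have a common face of
  codimension two.  Otherwise \<open>f\<close> plus a positive multiple of \<open>e\<close> would be a nonnegative
  combination \<open>z\<close> of normals that have nonpositive products with both \<open>e\<close> and \<open>f\<close>.  Then \<open>lor z
  z \<le> 0\<close>, but \<open>z\<close> is orthogonal to the timelike vector of \<open>v\<close>, so \<open>z = 0\<close>, and the
  half-spaces of \<open>e\<close> and \<open>f\<close> would be opposite.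
\<close>

lemma meeting_walls_adjacent:
  assumes v: "v \<in> Q" and e: "e \<in> normals Q" "lor (Rep_hyp v) e = 0"
    and f: "f \<in> normals Q" "lor (Rep_hyp v) f = 0" and ne: "e \<noteq> f"
  shows "f \<in> adjacent v e"
proof (rule ccontr)
  assume nadj: "f \<notin> adjacent v e"
  obtain A m l where fin: "finite A" and A: "A \<subseteq> adjacent v e" "\<forall>g\<in>A. 0 \<le> l g" "m < 0"
    and f_eq: "f = m *\<^sub>R e + (\<Sum>g\<in>A. l g *\<^sub>R g)"
    using wall_through_point_combination[OF v e f ne nadj] .
  define z where "z = (\<Sum>g\<in>A. l g *\<^sub>R g)"
  have z: "z = f - m *\<^sub>R e" using f_eq by (simp add: z_def)
  have "lor f z \<le> 0"
    unfolding z_def lor_sum_right lor_algebra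
  proof (rule sum_nonpos)
    fix g assume g: "g \<in> A"
    then have "lor f g \<le> 0"
      using lor_le_0_if_meet[OF v f, of g] A(1) nadj by (auto simp: adjacent_def)
    then show "l g * lor f g \<le> 0" using A(2) g by (simp add: mult_nonneg_nonpos)
  qed
  moreover have "lor e z \<le> 0" unfolding z_def by (rule lor_adjacent_sum_le_0[OF A(1,2) v e])
  then have "(- m) * lor e z \<le> 0" using A(3) by (intro mult_nonneg_nonpos) auto
  moreover have "lor z z = lor f z + (- m) * lor e z"
    by (subst (1) z) (simp add: lor_algebra)
  ultimately have "lor z z \<le> 0" by simp
  moreover have "lor z (Rep_hyp v) = 0"
    by (simp add: z lor_algebra lor_commute[of _ "Rep_hyp v"] e(2) f(2))
  ultimately have "z = 0"
    using lor_orth_eq_0[OF lor_Rep_hyp] lor_orth_nonneg[OF lor_Rep_hyp] by (metis order_antisym)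
  then have "f = m *\<^sub>R e" by (simp add: z)
  then have "lor (Rep_hyp p) f = m * lor (Rep_hyp p) e" by (simp add: lor_algebra)
  moreover have "m * lor (Rep_hyp p) e > 0"
    using A(3) p_strict_normals[OF e(1)] by (simp add: mult_neg_neg)
  ultimately show False using p_strict_normals[OF f(1)] by simp
qed

text \<open>
  The vector \<open>b + lor v b *\<^sub>R v\<close> is the projection of \<open>b\<close> to the tangent space at \<open>v\<close>,
  that is, the gradient of the function \<open>lor _ b\<close> on hyperbolic space.  At a maximum on the wall
  it has nonpositive product with every direction that points into the wall.
\<close>

lemma first_order_condition:
  assumes v: "v \<in> Q" "lor (Rep_hyp v) e = 0" and neg: "lor (Rep_hyp v) b < 0"
    and max: "\<forall>q\<in>Q. lor (Rep_hyp q) e = 0 \<longrightarrow> lor (Rep_hyp q) b \<le> lor (Rep_hyp v) b"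
    and x: "x \<in> local_cone v" "lor x e = 0"
  shows "lor x (b + lor (Rep_hyp v) b *\<^sub>R Rep_hyp v) \<le> 0"
proof (rule ccontr)
  assume contra: "\<not> ?thesis"
  define V where "V = Rep_hyp v"
  \<comment> \<open>The tangent component of \<open>x\<close> at \<open>v\<close>; the local cone contains the line of \<open>v\<close>.\<close>
  define y where "y = x + lor x V *\<^sub>R V"
  define k where "k = lor y b"
  define n where "n = - lor V b"
  define L where "L = lor y y"
  have VV: "lor V V = -1" by (simp add: V_def lor_Rep_hyp)
  have yV: "lor y V = 0" by (simp add: y_def lor_algebra VV)
  have k: "k > 0" using contra by (simp add: k_def y_def lor_algebra V_def lor_commute[of "Rep_hyp v" x] algebra_simps)
  have n: "n > 0" using neg by (simp add: n_def V_def)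
  have L: "L \<ge> 0" unfolding L_def by (rule lor_orth_nonneg[OF VV yV])
  have ye: "lor y e = 0" using v(2) x(2) by (simp add: y_def lor_algebra V_def)
  have "y \<in> local_cone v"
    using x(1) by (simp add: local_cone_def y_def lor_algebra V_def)
  then have "\<forall>\<^sub>F s in at_right 0. \<exists>q\<in>Q. \<exists>c>0. Rep_hyp q = c *\<^sub>R (V + s *\<^sub>R y)"
    unfolding V_def by (rule eventually_in_Q[OF v(1)])
  moreover have "\<forall>\<^sub>F s in at_right (0::real). 0 < s \<and> s < k / (n * L + 1)"
  proof -
    have "n * L + 1 > 0" using n L by (simp add: add_nonneg_pos)
    then have "0 < k / (n * L + 1)" using k by simp
    then show ?thesis by (auto simp: eventually_at_right_field)
  qed
  ultimately have "\<forall>\<^sub>F s in at_right (0::real). False"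
  proof eventually_elim
    case (elim s)
    then obtain q c where q: "q \<in> Q" "c > 0" "Rep_hyp q = c *\<^sub>R (V + s *\<^sub>R y)" by blast
    have "lor (Rep_hyp q) (Rep_hyp q) = c * c * (s * s * L - 1)"
      by (simp add: q(3) lor_algebra VV yV lor_commute[of V y] L_def algebra_simps)
    then have cc: "c * c * (1 - s * s * L) = 1" using lor_Rep_hyp[of q] by algebra
    have "c * c * (s * s * L) \<ge> 0" using L by simp
    then have "1 \<le> c * c" using cc by (simp add: algebra_simps)
    \<comment> \<open>As \<open>y\<close> is spacelike and orthogonal to \<open>V\<close>, the vector \<open>V + s *\<^sub>R y\<close> has to be scaled up, by a factor \<open>1 + O(s\<^sup>2)\<close>.\<close>
    then have c1: "1 \<le> c" using q(2) by (metis abs_le_square_iff abs_of_pos abs_one one_power2 power2_eq_square)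
    have "lor (Rep_hyp q) e = 0" using v(2) ye by (simp add: q(3) lor_algebra V_def)
    then have "lor (Rep_hyp q) b \<le> - n" using max q(1) by (simp add: n_def V_def)
    then have "c * (s * k - n) \<le> - n"
      by (simp add: q(3) lor_algebra n_def k_def add.commute)
    moreover have "n * (1 - s * s * L) * c \<le> n"
    proof -
      have "n * (1 - s * s * L) * c * c = n * (c * c * (1 - s * s * L))" by (simp only: ac_simps)
      then have "n * (1 - s * s * L) * c * c = n" by (simp only: cc mult_1_right)
      moreover have "0 \<le> 1 - s * s * L"
      proof (rule ccontr)
        assume "\<not> 0 \<le> 1 - s * s * L"
        then have "c * c * (1 - s * s * L) < 0" using q(2) by (intro mult_pos_neg) auto
        then show False using cc by simp
      qed
      then have "n * (1 - s * s * L) * c * 1 \<le> n * (1 - s * s * L) * c * c"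
        using n q(2) c1 by (intro mult_left_mono) auto
      ultimately show ?thesis by linarith
    qed
    ultimately have "c * (s * k) \<le> c * (s * (n * L * s))" by (simp add: algebra_simps)
    then have "k \<le> n * L * s" using q(2) elim(2) by simp
    also have "\<dots> \<le> (n * L + 1) * s" using elim(2) by (simp add: algebra_simps)
    also have "\<dots> < k" using elim(2) n L by (simp add: less_divide_eq add_nonneg_pos mult.commute)
    finally show False by simp
  qed
  then show False by simp
qed

text \<open>
  The product with \<open>f\<close> alone is bounded above on the wall, but its supremum may fail to be
  attained when the wall approaches the hyperplane of \<open>f\<close> at infinity.  Adding a small multiple
  of the product with the timelike vector \<open>(0, 1)\<close>, that is, of minus the height, makes the set
  of almost maximal points bounded.
\<close>

lemma attains_max_on_wall:
  assumes e: "e \<in> normals Q" and f: "f \<in> normals Q" and t: "t > 0"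
  obtains v where "v \<in> Q" "lor (Rep_hyp v) e = 0"
    "\<forall>q\<in>Q. lor (Rep_hyp q) e = 0 \<longrightarrow>
       lor (Rep_hyp q) (f + t *\<^sub>R (0, 1)) \<le> lor (Rep_hyp v) (f + t *\<^sub>R (0, 1))"
proof -
  let ?b = "f + t *\<^sub>R (0, 1)"
  have b: "lor y ?b = lor y f - t * snd y" for y by (simp add: lor_algebra) (simp add: lor_def)
  obtain q0 where q0: "q0 \<in> Q" "lor (Rep_hyp q0) e = 0"
    using face_nonempty[OF e] by (auto simp: hyperplane_def)
  define X where "X = {y. lor y y = -1} \<inter> {y. 0 \<le> snd y} \<inter> (\<Inter>g\<in>E. {y. lor y g \<le> 0}) \<inter> {y. lor y e = 0}
    \<inter> {y. lor (Rep_hyp q0) ?b \<le> lor y ?b}"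
  have Rep_X: "Rep_hyp q \<in> X \<longleftrightarrow> q \<in> Q \<and> lor (Rep_hyp q) e = 0 \<and> lor (Rep_hyp q0) ?b \<le> lor (Rep_hyp q) ?b" for q
    using snd_Rep_hyp[of q] by (auto simp: X_def lor_Rep_hyp Q_eq halfspace_def)
  have X_Rep: "\<exists>q. y = Rep_hyp q" if "y \<in> X" for y
  proof -
    have y: "lor y y = -1" "0 \<le> snd y" using that by (auto simp: X_def)
    then have "snd y \<noteq> 0"
      by (auto simp: lor_def) (metis inner_ge_zero not_one_le_zero neg_0_le_iff_le)
    then have "y \<in> {p. lor p p = -1 \<and> snd p > 0}" using y by simp
    then show ?thesis by (metis Abs_hyp_inverse)
  qed
  have fX: "lor y f \<le> 0" if "y \<in> X" for y
    using X_Rep[OF that] that normals_lor_le_0[OF _ f] Rep_X by blast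
  have cont: "continuous_on UNIV (\<lambda>y. lor y g)" for g :: "'a \<times> real"
    by (rule continuous_on_lor[OF continuous_on_id continuous_on_const])
  have "closed {y :: 'a \<times> real. lor y y = -1}"
    by (rule closed_Collect_eq[OF continuous_on_lor[OF continuous_on_id continuous_on_id] continuous_on_const])
  moreover have "closed {y :: 'a \<times> real. 0 \<le> snd y}"
    by (rule closed_Collect_le[OF continuous_on_const continuous_on_snd[OF continuous_on_id]])
  moreover have "closed (\<Inter>g\<in>E. {y. lor y g \<le> 0})"
    by (intro closed_INT ballI closed_Collect_le[OF cont continuous_on_const])
  ultimately have "closed X" unfolding X_def
    by (intro closed_Int closed_Collect_eq[OF cont continuous_on_const]
        closed_Collect_le[OF continuous_on_const cont])
  moreover have "bounded X"
    unfolding bounded_iff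
  proof (intro exI ballI)
    fix y assume y: "y \<in> X"
    define c where "c = - lor (Rep_hyp q0) ?b / t"
    have "t * snd y \<le> - lor (Rep_hyp q0) ?b"
      using y fX[OF y] b[of y] unfolding X_def by simp
    then have "snd y \<le> c" unfolding c_def pos_le_divide_eq[OF t] by (simp only: mult.commute)
    moreover have "0 \<le> snd y" "lor y y = -1" using y by (auto simp: X_def)
    moreover from this have "fst y \<bullet> fst y \<le> snd y ^ 2"
      by (simp add: lor_def power2_eq_square)
    then have "norm (fst y) ^ 2 \<le> snd y ^ 2" by (simp only: power2_norm_eq_inner)
    then have "norm (fst y) \<le> snd y" using \<open>0 \<le> snd y\<close> by (rule power2_le_imp_le)
    ultimately show "norm y \<le> 2 * (- lor (Rep_hyp q0) ?b / t)"
      using norm_Pair_le[of "fst y" "snd y"] by (simp add: c_def)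
  qed
  ultimately have "compact X" by (simp add: compact_eq_bounded_closed)
  moreover have "Rep_hyp q0 \<in> X" by (simp add: Rep_X q0)
  moreover have "continuous_on X (\<lambda>y. lor y ?b)" by (intro continuous_intros)
  ultimately obtain y where y: "y \<in> X" "\<forall>z\<in>X. lor z ?b \<le> lor y ?b"
    using continuous_attains_sup[of X "\<lambda>y. lor y ?b"] by blast
  then obtain v where v: "y = Rep_hyp v" using X_Rep by blast
  show thesis
  proof (rule that)
    show "v \<in> Q" "lor (Rep_hyp v) e = 0" using y(1) Rep_X v by auto
    show "\<forall>q\<in>Q. lor (Rep_hyp q) e = 0 \<longrightarrow> lor (Rep_hyp q) ?b \<le> lor (Rep_hyp v) ?b"
    proof (intro ballI impI)
      fix q assume q: "q \<in> Q" "lor (Rep_hyp q) e = 0"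
      have v0: "lor (Rep_hyp q0) ?b \<le> lor (Rep_hyp v) ?b" using y(1) Rep_X v by blast
      show "lor (Rep_hyp q) ?b \<le> lor (Rep_hyp v) ?b"
      proof (cases "lor (Rep_hyp q0) ?b \<le> lor (Rep_hyp q) ?b")
        case True
        then show ?thesis using y(2) q Rep_X v by blast
      next
        case False
        then show ?thesis using v0 by linarith
      qed
    qed
  qed
qed

text \<open>
  The first-order condition at the maximum, in the form in which it is used: \<open>m\<close> is the
  coefficient of \<open>e\<close> in the resulting combination, and the other terms have a sign, both against
  \<open>e\<close> and against the points \<open>w\<close> of the polyhedron.
\<close>

lemma multiplier_on_wall:
  assumes e: "e \<in> normals Q" and f: "f \<in> normals Q" and t: "t > 0"
  obtains v m where "v \<in> Q" "lor (Rep_hyp v) e = 0" "lor e f - t * snd e \<le> m"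
    "\<forall>w\<in>Q. lor (Rep_hyp w) f - t * snd (Rep_hyp w)
       + (lor (Rep_hyp v) f - t * snd (Rep_hyp v)) * lor (Rep_hyp v) (Rep_hyp w) \<le> m * lor (Rep_hyp w) e"
proof -
  let ?b = "f + t *\<^sub>R (0, 1)"
  have b: "lor y ?b = lor y f - t * snd y" for y by (simp add: lor_algebra) (simp add: lor_def)
  obtain v where v: "v \<in> Q" "lor (Rep_hyp v) e = 0"
    and max: "\<forall>q\<in>Q. lor (Rep_hyp q) e = 0 \<longrightarrow> lor (Rep_hyp q) ?b \<le> lor (Rep_hyp v) ?b"
    using attains_max_on_wall[OF e f t] by blast
  have "lor (Rep_hyp v) ?b < 0"
    unfolding b using normals_lor_le_0[OF v(1) f] t snd_Rep_hyp[of v] by (smt (verit) mult_pos_pos)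
  note comb = normal_combination[OF v(1) e v(2) first_order_condition[OF v this max]]
  obtain A m l where fin: "finite A" and A: "A \<subseteq> adjacent v e" "\<forall>g\<in>A. 0 \<le> l g"
    and eq: "?b + lor (Rep_hyp v) ?b *\<^sub>R Rep_hyp v = m *\<^sub>R e + (\<Sum>g\<in>A. l g *\<^sub>R g)"
    using comb .
  have "lor e ?b = lor e (?b + lor (Rep_hyp v) ?b *\<^sub>R Rep_hyp v)"
    using v(2) by (simp add: lor_algebra lor_commute[of e "Rep_hyp v"])
  also have "\<dots> = m + lor e (\<Sum>g\<in>A. l g *\<^sub>R g)"
    unfolding eq by (simp add: lor_algebra normals_unit[OF e])
  also have "\<dots> \<le> m" using lor_adjacent_sum_le_0[OF A v(1) e v(2)] by simp
  finally have 1: "lor e f - t * snd e \<le> m" by (simp only: b)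
  have 2: "lor (Rep_hyp w) f - t * snd (Rep_hyp w)
       + (lor (Rep_hyp v) f - t * snd (Rep_hyp v)) * lor (Rep_hyp v) (Rep_hyp w) \<le> m * lor (Rep_hyp w) e"
    if w: "w \<in> Q" for w
  proof -
    have "lor (Rep_hyp w) ?b + lor (Rep_hyp v) ?b * lor (Rep_hyp v) (Rep_hyp w)
        = lor (Rep_hyp w) (?b + lor (Rep_hyp v) ?b *\<^sub>R Rep_hyp v)"
      by (simp add: lor_algebra lor_commute[of "Rep_hyp w" "Rep_hyp v"])
    also have "\<dots> = m * lor (Rep_hyp w) e + (\<Sum>g\<in>A. l g * lor (Rep_hyp w) g)"
      unfolding eq by (simp add: lor_algebra lor_sum_right)
    finally have sum: "lor (Rep_hyp w) ?b + lor (Rep_hyp v) ?b * lor (Rep_hyp v) (Rep_hyp w)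
        = m * lor (Rep_hyp w) e + (\<Sum>g\<in>A. l g * lor (Rep_hyp w) g)" .
    have "(\<Sum>g\<in>A. l g * lor (Rep_hyp w) g) \<le> 0"
    proof (rule sum_nonpos)
      fix g assume "g \<in> A"
      then have "0 \<le> l g" "g \<in> normals Q" using A by (auto simp: adjacent_def)
      then show "l g * lor (Rep_hyp w) g \<le> 0"
        using normals_lor_le_0[OF w] by (simp add: mult_nonneg_nonpos)
    qed
    then show ?thesis using sum unfolding b by linarith
  qed
  show thesis by (rule that[OF v 1]) (use 2 in blast)
qed

text \<open>
  If the points \<open>v\<close> and \<open>w\<close> that realise the distance of two disjoint walls existed, the
  multipliers at these points would bound \<open>- lor e f\<close> from below by \<open>- lor v w\<close>, the hyperbolic
  cosine of their distance.  In general there are no such points, but the maxima of the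
  perturbed functions serve as well: adding the conditions on both walls, the error terms
  combine to a nonnegative number, and the perturbation tends to zero.
\<close>

lemma lor_le_minus_1_if_disjoint:
  assumes e: "e \<in> normals Q" and f: "f \<in> normals Q"
    and disj: "\<And>v. v \<in> Q \<Longrightarrow> lor (Rep_hyp v) e = 0 \<Longrightarrow> lor (Rep_hyp v) f \<noteq> 0"
  shows "lor e f \<le> -1"
proof -
  define k where "k = \<bar>snd e\<bar> + \<bar>snd f\<bar>"
  have bound: "1 \<le> - lor e f + t * k" if t: "t > 0" for t
  proof -
    obtain v m where v: "v \<in> Q" "lor (Rep_hyp v) e = 0" "lor e f - t * snd e \<le> m"
      "\<forall>w\<in>Q. lor (Rep_hyp w) f - t * snd (Rep_hyp w)
         + (lor (Rep_hyp v) f - t * snd (Rep_hyp v)) * lor (Rep_hyp v) (Rep_hyp w) \<le> m * lor (Rep_hyp w) e"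
      using multiplier_on_wall[OF e f t] .
    obtain w m' where w: "w \<in> Q" "lor (Rep_hyp w) f = 0" "lor f e - t * snd f \<le> m'"
      "\<forall>v\<in>Q. lor (Rep_hyp v) e - t * snd (Rep_hyp v)
         + (lor (Rep_hyp w) e - t * snd (Rep_hyp w)) * lor (Rep_hyp w) (Rep_hyp v) \<le> m' * lor (Rep_hyp v) f"
      using multiplier_on_wall[OF f e t] .
    define a a' B O1 O2 C where "a = - lor (Rep_hyp v) f" and "a' = - lor (Rep_hyp w) e"
      and "B = - lor (Rep_hyp v) (Rep_hyp w)" and "O1 = snd (Rep_hyp v)" and "O2 = snd (Rep_hyp w)"
      and "C = - lor e f + t * k"
    have a: "a > 0" using disj[OF v(1,2)] normals_lor_le_0[OF v(1) f] by (simp add: a_def)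
    have a': "a' > 0" using disj[OF w(1)] w(2) normals_lor_le_0[OF w(1) e] by (force simp: a'_def)
    have B: "B \<ge> 1" unfolding B_def by (rule lor_Rep_hyp_le)
    have pos: "O1 > 0" "O2 > 0" by (simp_all add: O1_def O2_def snd_Rep_hyp)
    have "t * snd e \<le> t * k" "t * snd f \<le> t * k"
      using t by (auto simp: k_def intro!: mult_left_mono)
    then have m: "- m \<le> C" "- m' \<le> C"
      using v(3) w(3) lor_commute[of f e] by (simp_all add: C_def)
    have "a * B + t * (O1 * B - O2) \<le> (- m) * a'"
      using bspec[OF v(4) w(1)] w(2) by (simp add: a_def a'_def B_def O1_def O2_def algebra_simps)
    also have "\<dots> \<le> C * a'" using m(1) a' by (intro mult_right_mono) auto
    finally have 1: "a * B + t * (O1 * B - O2) \<le> C * a'" .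
    have "a' * B + t * (O2 * B - O1) \<le> (- m') * a"
      using bspec[OF w(4) v(1)] v(2) lor_commute[of "Rep_hyp w" "Rep_hyp v"]
      by (simp add: a_def a'_def B_def O1_def O2_def algebra_simps)
    also have "\<dots> \<le> C * a" using m(2) a by (intro mult_right_mono) auto
    \<comment> \<open>Neither of the error terms \<open>O1 * B - O2\<close> and \<open>O2 * B - O1\<close> has a sign, but their sum does.\<close>
    finally have "(a + a') * B + t * ((O1 + O2) * (B - 1)) \<le> C * (a + a')"
      using 1 by (simp add: algebra_simps)
    moreover have "0 \<le> t * ((O1 + O2) * (B - 1))" using t pos B by simp
    moreover have "(a + a') * 1 \<le> (a + a') * B" using a a' B by (intro mult_left_mono) auto
    ultimately have "(a + a') * 1 \<le> (a + a') * C" by (simp add: mult.commute)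
    then show ?thesis using a a' by (simp add: C_def)
  qed
  show ?thesis
  proof (rule ccontr)
    assume "\<not> ?thesis"
    then have d: "1 + lor e f > 0" by simp
    have k: "k \<ge> 0" by (simp add: k_def)
    have "1 \<le> - lor e f + (1 + lor e f) / (k + 1) * k"
      using d k by (intro bound) simp
    moreover have "(1 + lor e f) / (k + 1) * k < 1 + lor e f"
      using d k by (simp add: divide_simps)
    ultimately show False by simp
  qed
qed

end

section \<open>Alternating words in two involutions\<close>

fun alt :: "'s \<Rightarrow> 's \<Rightarrow> nat \<Rightarrow> 's list" where
  "alt s t 0 = []"
| "alt s t (Suc n) = s # alt t s n"

lemma length_alt [simp]: "length (alt s t n) = n"
  by (induction n arbitrary: s t) auto

lemma set_alt: "set (alt s t n) \<subseteq> {s, t}"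
  by (induction n arbitrary: s t) auto

lemma take_alt: "take k (alt s t n) = alt s t (min k n)"
proof (induction n arbitrary: s t k)
  case (Suc n)
  then show ?case by (cases k) auto
qed simp

lemma distinct_adj_imp_alt:
  assumes "set us \<subseteq> {s, t}" "distinct_adj us"
  shows "us = alt s t (length us) \<or> us = alt t s (length us)"
  using assms
proof (induction us)
  case (Cons x xs)
  then have IH: "xs = alt s t (length xs) \<or> xs = alt t s (length xs)" and x: "x = s \<or> x = t"
    by (auto simp: distinct_adj_Cons)
  show ?case
  proof (cases "length xs")
    case 0
    then show ?thesis using x by auto
  next
    case (Suc n)
    then have "hd xs \<noteq> x" using Cons.prems(2) by (cases xs) auto
    then show ?thesis using IH x Suc by auto
  qed
qed simp

lemma not_distinct_adj_decomp:
  assumes "\<not> distinct_adj us" obtains as x bs where "us = as @ x # x # bs"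
proof -
  have "\<exists>as x bs. us = as @ x # x # bs"
    using assms
  proof (induction us rule: induct_list012)
    case (3 x y zs)
    show ?case
    proof (cases "x = y")
      case True
      then show ?thesis by (metis append_Nil)
    next
      case False
      then have "\<not> distinct_adj (y # zs)" using 3(3) by simp
      then show ?thesis using 3(2) by (metis append_Cons)
    qed
  qed auto
  then show thesis using that by blast
qed

lemma reduced_imp_distinct_adj:
  assumes inv: "\<And>s x. s \<in> X \<Longrightarrow> T s (T s x) = x"
    and us: "set us \<subseteq> X" "length us = wlen T X (act T us)"
  shows "distinct_adj us"
proof (rule ccontr)
  assume "\<not> distinct_adj us"
  then obtain as x bs where eq: "us = as @ x # x # bs" by (rule not_distinct_adj_decomp)
  have "act T us = act T (as @ bs)" using inv us(1) by (auto simp: eq fun_eq_iff)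
  moreover have "set (as @ bs) \<subseteq> X" using us(1) by (auto simp: eq)
  ultimately have "wlen T X (act T us) \<le> length (as @ bs)" by (metis wlen_le)
  then show False using us(2) by (simp add: eq)
qed

text \<open>
  A longer alternating word contains \<open>s # alt t s m\<close>, in which the relation makes the two first
  letters cancel.
\<close>

lemma reduced_alt_le:
  assumes inv: "\<And>x. T s (T s x) = x" "\<And>x. T t (T t x) = x"
    and m: "m > 0" and rel: "act T (alt s t m) = act T (alt t s m)"
    and red: "k \<le> wlen T {s, t} (act T (alt s t k))"
  shows "k \<le> m"
proof (rule ccontr)
  assume "\<not> k \<le> m"
  then have k: "m < k" by simp
  obtain j where j: "m = Suc j" using m by (cases m) auto
  define r where "r = drop (Suc m) (alt s t k)"
  have "alt s t k = take (Suc m) (alt s t k) @ r" by (simp add: r_def)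
  also have "take (Suc m) (alt s t k) = s # alt t s m" using k by (simp add: take_alt)
  finally have "act T (alt s t k) = T s \<circ> act T (alt t s m) \<circ> act T r" by (simp add: comp_assoc)
  also have "\<dots> = T s \<circ> act T (alt s t m) \<circ> act T r" by (simp add: rel)
  also have "\<dots> = act T (alt t s j @ r)" using inv by (auto simp: j fun_eq_iff)
  finally have "wlen T {s, t} (act T (alt s t k)) = wlen T {s, t} (act T (alt t s j @ r))" by simp
  also have "set r \<subseteq> {s, t}" 
    unfolding r_def by (rule order_trans[OF set_drop_subset set_alt])
  then have "wlen T {s, t} (act T (alt t s j @ r)) \<le> length (alt t s j @ r)"
    using set_alt[of t s j] by (intro wlen_le) auto
  finally show False using red k by (simp add: r_def j)
qed

text \<open>
  The rank two condition of Tits's lemma.  A shortest word is alternating, and its first letter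
  decides on which side of the wall of \<open>s\<close> the wedge is moved.  The case \<open>m = 0\<close> stands for the
  infinite dihedral group.  A word of the maximal length \<open>m\<close> may be taken to start with either
  letter.
\<close>

lemma dihedral_rank_two:
  assumes inv: "\<And>x. T s (T s x) = x" "\<And>x. T t (T t x) = x"
    and rel: "m > 0 \<Longrightarrow> act T (alt s t m) = act T (alt t s m)"
    and pos: "\<And>n x. m = 0 \<or> n < m \<Longrightarrow> x \<in> A \<inter> B \<Longrightarrow> act T (alt t s n) x \<in> A"
    and us: "set us \<subseteq> {s, t}"
  shows "(\<forall>x\<in>A \<inter> B. act T us x \<in> A) \<or>
      (\<forall>x\<in>A \<inter> B. T s (act T us x) \<in> A) \<and>
        wlen T {s, t} (T s \<circ> act T us) < wlen T {s, t} (act T us)"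
proof -
  obtain vs where vs: "set vs \<subseteq> {s, t}" "length vs = wlen T {s, t} (act T us)" "act T vs = act T us"
    using wlen_witness[OF us] .
  define k where "k = wlen T {s, t} (act T us)"
  have inv': "\<And>r x. r \<in> {s, t} \<Longrightarrow> T r (T r x) = x" using inv by auto
  have "length vs = wlen T {s, t} (act T vs)" using vs by simp
  then have "distinct_adj vs"
    using reduced_imp_distinct_adj[of "{s, t}" T vs] inv' vs(1) by blast
  then have alt: "vs = alt s t k \<or> vs = alt t s k"
    using distinct_adj_imp_alt[OF vs(1)] vs(2) by (simp add: k_def)
  have start: ?thesis if eq: "act T us = act T (alt s t k)" and km: "m = 0 \<or> k \<le> m"
  proof (cases k)
    case 0
    then show ?thesis using eq by simp
  next
    case (Suc j)
    have T: "T s \<circ> act T us = act T (alt t s j)" using inv(1) by (auto simp: eq Suc fun_eq_iff)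
    have "wlen T {s, t} (act T (alt t s j)) \<le> j"
      using wlen_le[of "alt t s j" "{s, t}" T] set_alt[of t s j] by auto
    then have "wlen T {s, t} (T s \<circ> act T us) < wlen T {s, t} (act T us)"
      using Suc by (simp add: T k_def)
    moreover have "T s (act T us x) \<in> A" if "x \<in> A \<inter> B" for x
      using pos[of j, OF _ that] km Suc T by (metis Suc_le_lessD comp_apply)
    ultimately show ?thesis by blast
  qed
  from alt show ?thesis
  proof
    assume v: "vs = alt s t k"
    have "m = 0 \<or> k \<le> m"
      using reduced_alt_le[of T s t m k] inv rel vs v by (cases "m = 0") (auto simp: k_def)
    then show ?thesis using start vs(3) v by simp
  next
    assume v: "vs = alt t s k"
    have km: "m = 0 \<or> k \<le> m"
      using reduced_alt_le[of T t s m k] inv rel vs v by (cases "m = 0") (auto simp: k_def insert_commute)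
    show ?thesis
    proof (cases "m = 0 \<or> k < m")
      case True
      then show ?thesis using pos[of k] vs(3) v by auto
    next
      case False
      then have "act T us = act T (alt s t k)" using km vs(3) v rel by auto
      then show ?thesis using start km by blast
    qed
  qed
qed

section \<open>Products of two reflections\<close>

text \<open>
  Chebyshev polynomials of the second kind, shifted by one: the coefficients that occur when an
  alternating product of two reflections is applied to a vector.
\<close>

fun chebyshev_U :: "real \<Rightarrow> nat \<Rightarrow> real" where
  "chebyshev_U c 0 = 0"
| "chebyshev_U c (Suc 0) = 1"
| "chebyshev_U c (Suc (Suc n)) = 2 * c * chebyshev_U c (Suc n) - chebyshev_U c n"

lemma chebyshev_U_sin: "chebyshev_U (cos a) n * sin a = sin (real n * a)"
proof (induction "cos a" n rule: chebyshev_U.induct)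
  case (3 n)
  have 1: "sin (real (Suc (Suc n)) * a) = sin (real (Suc n) * a) * cos a + cos (real (Suc n) * a) * sin a"
    using sin_add[of "real (Suc n) * a" a] by (simp add: algebra_simps)
  have 2: "sin (real n * a) = sin (real (Suc n) * a) * cos a - cos (real (Suc n) * a) * sin a"
    using sin_diff[of "real (Suc n) * a" a] by (simp add: algebra_simps)
  have "chebyshev_U (cos a) (Suc (Suc n)) * sin a
      = 2 * cos a * (chebyshev_U (cos a) (Suc n) * sin a) - chebyshev_U (cos a) n * sin a"
    by (simp add: algebra_simps)
  also have "\<dots> = sin (real (Suc (Suc n)) * a)"
    unfolding 3 1 2 by simp
  finally show ?case .
qed auto

lemma chebyshev_U_mono:
  assumes "c \<ge> 1" shows "0 \<le> chebyshev_U c n \<and> chebyshev_U c n < chebyshev_U c (Suc n)"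
proof (induction n)
  case (Suc n)
  have "2 * 1 * chebyshev_U c (Suc n) \<le> 2 * c * chebyshev_U c (Suc n)"
    using Suc assms by (intro mult_right_mono) auto
  then show ?case using Suc unfolding chebyshev_U.simps by linarith
qed simp

text \<open>
  The reflection in \<open>f\<close> changes the product with \<open>e\<close> by a multiple of the product with \<open>f\<close>,
  which after the preceding reflection in \<open>e\<close> is given by the same formula with \<open>e\<close> and \<open>f\<close>
  exchanged; this is the three-term recurrence.
\<close>

lemma lor_alt:
  assumes "lor e e = 1" "lor f f = 1"
  defines "u \<equiv> chebyshev_U (- lor e f)"
  shows "lor (Rep_hyp (act hrefl (alt f e n) x)) e =
    (if even n then u (Suc n) * lor (Rep_hyp x) e + u n * lor (Rep_hyp x) f
     else u (Suc n) * lor (Rep_hyp x) f + u n * lor (Rep_hyp x) e)"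
proof -
  have "lor (Rep_hyp (act hrefl (alt f e n) x)) e =
    (if even n then chebyshev_U c (Suc n) * lor (Rep_hyp x) e + chebyshev_U c n * lor (Rep_hyp x) f
     else chebyshev_U c (Suc n) * lor (Rep_hyp x) f + chebyshev_U c n * lor (Rep_hyp x) e)"
    if "lor e e = 1" "lor f f = 1" "c = - lor e f" for c
    using that
  proof (induction c n arbitrary: e f rule: chebyshev_U.induct)
    case (2 c)
    then show ?case by (simp add: Rep_hrefl lor_algebra lor_commute[of f e])
  next
    case (3 c n)
    define y where "y = act hrefl (alt f e n) x"
    have fe: "lor f e = - c" using 3(5) by (simp add: lor_commute[of f e])
    have 1: "lor (Rep_hyp (hrefl e y)) f =
     (if even (Suc n) then chebyshev_U c (Suc (Suc n)) * lor (Rep_hyp x) f + chebyshev_U c (Suc n) * lor (Rep_hyp x) e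
     else chebyshev_U c (Suc (Suc n)) * lor (Rep_hyp x) e + chebyshev_U c (Suc n) * lor (Rep_hyp x) f)"
      using 3(1)[of f e] 3(3,4) fe by (simp add: y_def)
    have 2: "lor (Rep_hyp y) e = (if even n then chebyshev_U c (Suc n) * lor (Rep_hyp x) e + chebyshev_U c n * lor (Rep_hyp x) f
     else chebyshev_U c (Suc n) * lor (Rep_hyp x) f + chebyshev_U c n * lor (Rep_hyp x) e)"
      unfolding y_def by (rule 3(2)[OF 3(3,4,5)])
    have "lor (Rep_hyp (act hrefl (alt f e (Suc (Suc n))) x)) e
        = lor (Rep_hyp (hrefl e y)) e + 2 * c * lor (Rep_hyp (hrefl e y)) f"
      using 3(4) fe by (simp add: y_def Rep_hrefl lor_algebra)
    also have "lor (Rep_hyp (hrefl e y)) e = - lor (Rep_hyp y) e"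
      using 3(3) by (simp add: Rep_hrefl lor_algebra)
    finally have 3: "lor (Rep_hyp (act hrefl (alt f e (Suc (Suc n))) x)) e
        = - lor (Rep_hyp y) e + 2 * c * lor (Rep_hyp (hrefl e y)) f" .
    show ?case unfolding 3 1 2 by (simp add: algebra_simps)
  qed simp
  from this[OF assms(1,2)] show ?thesis by (simp add: u_def)
qed

text \<open>
  An alternating word shorter than \<open>m\<close> that starts with \<open>f\<close> maps the wedge to the inner side of
  the wall of \<open>e\<close>: the coefficients in \<open>lor_alt\<close> are nonnegative and not both zero, which holds
  for an angle \<open>pi / m\<close> because \<open>sin (n * pi / m)\<close> is nonnegative for \<open>n \<le> m\<close>, and for \<open>m =
  0\<close> because they increase with \<open>n\<close>.
\<close>

lemma alt_negative:
  assumes e: "lor e e = 1" and f: "lor f f = 1"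
    and m: "m = 0 \<and> lor e f \<le> -1 \<or> m \<ge> 2 \<and> lor e f = - cos (pi / real m)"
    and n: "m = 0 \<or> n < m"
    and x: "lor (Rep_hyp x) e < 0" "lor (Rep_hyp x) f < 0"
  shows "lor (Rep_hyp (act hrefl (alt f e n) x)) e < 0"
proof -
  let ?u = "chebyshev_U (- lor e f)"
  have u: "0 \<le> ?u n \<and> 0 \<le> ?u (Suc n) \<and> (0 < ?u n \<or> 0 < ?u (Suc n))"
  proof (cases "m = 0")
    case True
    then show ?thesis using chebyshev_U_mono[of "- lor e f" n] m by auto
  next
    case False
    define a where "a = pi / real m"
    have m2: "m \<ge> 2" and c: "- lor e f = cos a" and nm: "n < m" using False m n by (auto simp: a_def)
    have ma: "real m * a = pi" using m2 by (simp add: a_def)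
    have a: "0 < a" "a < pi" using m2 by (auto simp: a_def divide_less_eq)
    then have sa: "sin a > 0" by (rule sin_gt_zero)
    have "real k * a \<le> pi" if "k \<le> m" for k
      using that a mult_right_mono[of "real k" "real m" a] ma by simp
    then have "0 \<le> sin (real k * a)" if "k \<le> m" for k
      using that a by (intro sin_ge_zero) auto
    then have 1: "0 \<le> ?u k" if "k \<le> m" for k
      using chebyshev_U_sin[of a k] sa that unfolding c by (metis not_le mult_neg_pos)
    have 2: "0 < ?u n" if "n > 0"
    proof -
      have "real n * a < pi" using nm a mult_strict_right_mono[of "real n" "real m" a] ma by simp
      then have "0 < sin (real n * a)" using a that by (intro sin_gt_zero) auto
      then show ?thesis using chebyshev_U_sin[of a n] sa unfolding c by (metis zero_less_mult_pos2)
    qed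
    show ?thesis using 1[of n] 1[of "Suc n"] 2 nm by (cases n) auto
  qed
  have neg: "p * r + q * s < 0" if "0 \<le> p" "0 \<le> q" "0 < p \<or> 0 < q" "r < 0" "s < 0" for p q r s :: real
    using that by (smt (verit) mult_nonneg_nonpos mult_pos_neg)
  show ?thesis unfolding lor_alt[OF e f] using u x by (auto intro!: neg)
qed

lemma Rep_act_two:
  assumes "lor e e = 1" "lor f f = 1" "set ws \<subseteq> {e, f}"
  shows "\<exists>a b. Rep_hyp (act hrefl ws x) = Rep_hyp x + a *\<^sub>R e + b *\<^sub>R f"
  using assms(3)
proof (induction ws)
  case Nil
  then show ?case by (intro exI[of _ 0]) simp
next
  case (Cons w ws)
  then obtain a b where ab: "Rep_hyp (act hrefl ws x) = Rep_hyp x + a *\<^sub>R e + b *\<^sub>R f" by auto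
  define k where "k = - 2 * lor (Rep_hyp (act hrefl ws x)) w"
  have w: "w = e \<or> w = f" using Cons.prems by auto
  then have eq: "Rep_hyp (act hrefl (w # ws) x) = Rep_hyp x + a *\<^sub>R e + b *\<^sub>R f + k *\<^sub>R w"
    using assms(1,2) by (auto simp: Rep_hrefl ab k_def)
  from w show ?case
  proof
    assume "w = e"
    then have "Rep_hyp (act hrefl (w # ws) x) = Rep_hyp x + (a + k) *\<^sub>R e + b *\<^sub>R f"
      unfolding eq by (simp add: algebra_simps)
    then show ?thesis by blast
  next
    assume "w = f"
    then have "Rep_hyp (act hrefl (w # ws) x) = Rep_hyp x + a *\<^sub>R e + (b + k) *\<^sub>R f"
      unfolding eq by (simp add: algebra_simps)
    then show ?thesis by blast
  qed
qed

text \<open>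
  Both products differ from the identity by vectors in the span of \<open>e\<close> and \<open>f\<close>, on which the
  form is nondegenerate, so it suffices to compare products with \<open>e\<close> and \<open>f\<close>; these are given by
  \<open>lor_alt\<close>.
\<close>

lemma braid_relation:
  assumes e: "lor e e = 1" and f: "lor f f = 1"
    and m: "m \<ge> 2" "lor e f = - cos (pi / real m)"
  shows "act hrefl (alt e f m) = act hrefl (alt f e m)"
proof
  fix x
  define a where "a = pi / real m"
  define u where "u = chebyshev_U (cos a)"
  have c: "- lor e f = cos a" "- lor f e = cos a" using m(2) by (simp_all add: a_def lor_commute[of f e])
  have ma: "real m * a = pi" using m by (simp add: a_def)
  have "0 < a" "a < pi" using m by (auto simp: a_def divide_less_eq)
  then have sa: "sin a > 0" by (rule sin_gt_zero)
  obtain j where j: "m = Suc j" using m(1) by (cases m) auto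
  have "u m * sin a = 0" using chebyshev_U_sin[of a m] ma by (simp add: u_def)
  then have um: "u m = 0" using sa by simp
  have "real (Suc m) * a = a + pi" "real j * a = pi - a" using ma by (auto simp: j algebra_simps)
  then have "u (Suc m) * sin a = (-1) * sin a" "u j * sin a = 1 * sin a"
    using chebyshev_U_sin[of a "Suc m"] chebyshev_U_sin[of a j] by (simp_all add: u_def)
  then have us: "u (Suc m) = -1" "u j = 1" using sa by (simp_all only: mult_cancel_right) auto
  note val = lor_alt[OF e f, of _ x, unfolded c, folded u_def]
    lor_alt[OF f e, of _ x, unfolded c, folded u_def]
  define y z where "y = act hrefl (alt f e m) x" and "z = act hrefl (alt e f m) x"
  have y: "y = hrefl f (act hrefl (alt e f j) x)" and z: "z = hrefl e (act hrefl (alt f e j) x)"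
    by (simp_all add: y_def z_def j)
  have ze: "lor (Rep_hyp z) e = - lor (Rep_hyp (act hrefl (alt f e j) x)) e"
    and yf: "lor (Rep_hyp y) f = - lor (Rep_hyp (act hrefl (alt e f j) x)) f"
    by (simp_all add: z y Rep_hrefl e f lor_algebra)
  have "lor (Rep_hyp y) e = lor (Rep_hyp z) e"
    unfolding ze val y_def using um us by (simp add: j)
  moreover have "lor (Rep_hyp y) f = lor (Rep_hyp z) f"
    unfolding yf val z_def using um us by (simp add: j)
  moreover obtain a1 b1 a2 b2 where ab: "Rep_hyp y = Rep_hyp x + a1 *\<^sub>R e + b1 *\<^sub>R f"
      "Rep_hyp z = Rep_hyp x + a2 *\<^sub>R e + b2 *\<^sub>R f"
    using Rep_act_two[OF e f, of "alt f e m" x] Rep_act_two[OF e f, of "alt e f m" x]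
      set_alt[of f e m] set_alt[of e f m] by (auto simp: y_def z_def insert_commute)
  ultimately have d0: "lor (Rep_hyp y - Rep_hyp z) e = 0" "lor (Rep_hyp y - Rep_hyp z) f = 0"
    by (simp_all add: lor_algebra)
  define p q where "p = a1 - a2" and "q = b1 - b2"
  have d: "Rep_hyp y - Rep_hyp z = p *\<^sub>R e + q *\<^sub>R f"
    by (simp add: ab p_def q_def scaleR_diff_left)
  have "p + q * lor f e = 0" "p * lor e f + q = 0"
    using d0 e f unfolding d by (simp_all add: lor_algebra)
  then have "p = q * (- lor f e)" "q = p * (- lor e f)" by simp_all
  then have pq: "p = q * cos a" "q = p * cos a" unfolding c .
  have "p * (1 - (cos a)\<^sup>2) = 0" using pq by algebra
  then have "p = 0" using sa by (simp add: sin_squared_eq[symmetric])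
  moreover from this have "q = 0" using pq(2) by simp
  ultimately have "Rep_hyp y = Rep_hyp z" using d by simp
  then show "act hrefl (alt e f m) x = act hrefl (alt f e m) x"
    by (simp add: Rep_hyp_inject y_def z_def)
qed

lemma act_alt_even_id:
  assumes "T t = id"
  shows "act T (alt s t (2 * k)) = T s ^^ k" "act T (alt t s (2 * k)) = T s ^^ k"
  by (induction k) (simp_all add: assms funpow_swap1)

section \<open>Stabilisers for an action on a path\<close>

text \<open>
  On the path with vertices \<open>0, ..., I - 1\<close>, the map exchanges the end points of every edge
  whose lower end point is even (for \<open>b = True\<close>) or odd (for \<open>b = False\<close>), and fixes all other
  numbers.
\<close>

definition path_step :: "nat \<Rightarrow> bool \<Rightarrow> nat \<Rightarrow> nat" where
  "path_step I b i =
    (if i < I then if even i = b then (if Suc i < I then Suc i else i) else i - 1 else i)"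

lemma path_step_involution: "path_step I b (path_step I b i) = i"
  by (cases i) (auto simp: path_step_def)

lemma path_step_less: "i < I \<Longrightarrow> path_step I b i < I"
  by (auto simp: path_step_def)

lemma path_step_cases:
  assumes "i < I"
  obtains "path_step I b i = i"
  | "path_step I b i = Suc i" "b = even i"
  | j where "i = Suc j" "path_step I b i = j" "b = even j"
proof (cases "even i = b")
  case True
  then have b: "b = even i" by simp
  show thesis
  proof (cases "Suc i < I")
    case True
    then have "path_step I b i = Suc i" using assms by (simp add: path_step_def b)
    then show thesis using b by (rule that(2))
  next
    case False
    then have "path_step I b i = i" by (simp add: path_step_def b)
    then show thesis by (rule that(1))
  qed
next
  case False
  then have step: "path_step I b i = i - 1" and b: "b = odd i"
    using assms by (auto simp: path_step_def)
  show thesis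
  proof (cases i)
    case 0
    then have "path_step I b i = i" using step by simp
    then show thesis by (rule that(1))
  next
    case (Suc j)
    then have "path_step I b i = j" "b = even j" using step b by simp_all
    then show thesis using Suc by (intro that(3))
  qed
qed

text \<open>
  Two of the generators act on the path by the two kinds of edges, all other ones trivially.
  The last assumption says that this defines an action of the group generated by the maps \<open>h s\<close>.
\<close>

locale path_action =
  fixes h :: "'s \<Rightarrow> 'b \<Rightarrow> 'b" and S :: "'s set" and \<sigma> :: "'s \<Rightarrow> nat \<Rightarrow> nat"
    and a b :: 's and I :: nat
  assumes h_inv: "s \<in> S \<Longrightarrow> h s (h s x) = x"
    and ab: "a \<in> S" "b \<in> S" "a \<noteq> b" and I_pos: "I > 0"
    and \<sigma>_def: "\<sigma> s = (if s = a then path_step I True else if s = b then path_step I False else id)"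
    and faithful: "set ws \<subseteq> S \<Longrightarrow> act h ws = id \<Longrightarrow> act \<sigma> ws = id"
begin

lemma \<sigma>_involution: "\<sigma> s (\<sigma> s i) = i"
  by (simp add: \<sigma>_def path_step_involution)

lemma h_cancel:
  assumes "set ws \<subseteq> S"
  shows "act h (rev ws) (act h ws x) = x" "act h ws (act h (rev ws) x) = x"
  using act_rev_cancel[of ws h x] assms h_inv by auto

lemma \<sigma>_cancel: "act \<sigma> (rev ws) (act \<sigma> ws i) = i" "act \<sigma> ws (act \<sigma> (rev ws) i) = i"
  using act_rev_cancel[of ws \<sigma> i] \<sigma>_involution by auto

lemma well_defined:
  assumes "set us \<subseteq> S" "set vs \<subseteq> S" "act h us = act h vs"
  shows "act \<sigma> us = act \<sigma> vs"
proof -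
  have "act h (rev us @ vs) = id"
    using h_cancel(1)[OF assms(1)] by (simp add: fun_eq_iff assms(3)[symmetric])
  then have "act \<sigma> (rev us @ vs) = id" using assms by (intro faithful) auto
  then have "act \<sigma> us (act \<sigma> (rev us) (act \<sigma> vs i)) = act \<sigma> us i" for i
    by (simp add: fun_eq_iff)
  then show ?thesis by (simp add: \<sigma>_cancel fun_eq_iff)
qed

lemma well_defined_rev:
  assumes "set us \<subseteq> S" "set vs \<subseteq> S" "act h us = act h vs"
  shows "act \<sigma> (rev us) = act \<sigma> (rev vs)"
  using well_defined[OF assms] \<sigma>_cancel by (metis ext)

lemma act_\<sigma>_less: "i < I \<Longrightarrow> act \<sigma> ws i < I"
  by (induction ws) (auto simp: \<sigma>_def path_step_less)

text \<open>
  The alternating word that moves \<open>0\<close> to \<open>i\<close> along the path.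
\<close>

fun path_word :: "nat \<Rightarrow> 's list" where
  "path_word 0 = []"
| "path_word (Suc i) = (if even i then a else b) # path_word i"

lemma set_path_word: "set (path_word i) \<subseteq> S"
  using ab by (induction i) auto

lemma act_path_word: "i < I \<Longrightarrow> act \<sigma> (path_word i) 0 = i"
  using ab by (induction i) (auto simp: \<sigma>_def path_step_def)

definition stab :: "('b \<Rightarrow> 'b) set" where
  "stab = {act h ws | ws. set ws \<subseteq> S \<and> act \<sigma> ws 0 = 0}"

text \<open>
  They include the Schreier generators of the stabiliser for the transversal formed by the path
  words.  Arbitrary words \<open>us\<close> are allowed because only the shape of a conjugate matters.
\<close>

definition schreier_generators :: "('b \<Rightarrow> 'b) set" where
  "schreier_generators = {act h (rev us @ s # us) | us s. set us \<subseteq> S \<and> s \<in> S} \<inter> stab"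

text \<open>
  Schreier's argument.  The word is multiplied by the inverse of the path word that leads to its
  image of \<open>0\<close>.  If the new letter moves the current vertex, then it moves it along the path,
  and the path word absorbs the letter.  If it fixes the vertex, then a conjugate of the letter
  that belongs to the stabiliser splits off.  So the stabiliser is generated by conjugates of
  generators.
\<close>

lemma stab_induct:
  assumes ws: "set ws \<subseteq> S" and P1: "P id"
    and P2: "\<And>r g. r \<in> schreier_generators \<Longrightarrow> P g \<Longrightarrow> P (r \<circ> g)"
  shows "P (act h (rev (path_word (act \<sigma> ws 0)) @ ws))"
  using ws
proof (induction ws)
  case Nil
  then show ?case using P1 by (simp add: id_def)
next
  case (Cons s ws)
  define i where "i = act \<sigma> ws 0"
  have IH: "P (act h (rev (path_word i) @ ws))"
    unfolding i_def by (rule Cons.IH) (use Cons.prems in simp)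
  have s: "s \<in> S" and ws: "set ws \<subseteq> S" using Cons.prems by auto
  have i: "i < I" using act_\<sigma>_less I_pos by (simp add: i_def)
  consider "\<sigma> s i = i" | "\<sigma> s i = Suc i" "s = (if even i then a else b)"
    | j where "i = Suc j" "\<sigma> s i = j" "s = (if even j then a else b)"
  proof (cases "s = a \<or> s = b")
    case True
    define p where "p = (s = a)"
    have \<sigma>s: "\<sigma> s = path_step I p" using True by (auto simp: \<sigma>_def p_def)
    have sp: "s = (if p then a else b)" using True by (auto simp: p_def)
    show thesis
    proof (rule path_step_cases[OF i, of p])
      assume "path_step I p i = i"
      then show thesis by (intro that(1)) (simp add: \<sigma>s)
    next
      assume step: "path_step I p i = Suc i" and p: "p = even i"
      show thesis
        by (rule that(2)) (simp only: \<sigma>s step, use sp in \<open>simp only: p\<close>)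
    next
      fix j assume j: "i = Suc j" and step: "path_step I p i = j" and p: "p = even j"
      show thesis
        by (rule that(3)[OF j]) (simp only: \<sigma>s step, use sp in \<open>simp only: p\<close>)
    qed
  next
    case False
    then show thesis using that(1) by (simp add: \<sigma>_def)
  qed
  then have goal: "P (act h (rev (path_word (\<sigma> s i)) @ s # ws))"
  proof cases
    case 1
    let ?r = "act h (rev (path_word i) @ s # path_word i)"
    have "act \<sigma> (rev (path_word i) @ s # path_word i) 0 = 0"
      using 1 act_path_word[OF i] \<sigma>_cancel(1)[of "path_word i" 0] by simp
    moreover have "set (rev (path_word i) @ s # path_word i) \<subseteq> S" using s set_path_word by auto
    ultimately have "?r \<in> stab" unfolding stab_def by blast
    moreover have "\<exists>us t. ?r = act h (rev us @ t # us) \<and> set us \<subseteq> S \<and> t \<in> S"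
      using s set_path_word by blast
    ultimately have r: "?r \<in> schreier_generators" unfolding schreier_generators_def by blast
    have eq: "act h (rev (path_word (\<sigma> s i)) @ s # ws) = ?r \<circ> act h (rev (path_word i) @ ws)"
      using 1 by (simp add: fun_eq_iff h_cancel(2)[OF set_path_word])
    show ?thesis unfolding eq by (rule P2[OF r IH])
  next
    case 2
    have eq: "act h (rev (path_word (\<sigma> s i)) @ s # ws) = act h (rev (path_word i) @ ws)"
      using 2 s h_inv by (simp add: fun_eq_iff)
    show ?thesis unfolding eq by (rule IH)
  next
    case 3
    have "path_word i = s # path_word (\<sigma> s i)" using 3 by simp
    then have eq: "act h (rev (path_word (\<sigma> s i)) @ s # ws) = act h (rev (path_word i) @ ws)"
      by (simp add: fun_eq_iff)
    show ?thesis unfolding eq by (rule IH)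
  qed
  have "act \<sigma> (s # ws) 0 = \<sigma> s i" by (simp add: i_def)
  then show ?case using goal by (simp only:)
qed

lemma stab_schreier_induct:
  assumes g: "g \<in> stab" and P1: "P id"
    and P2: "\<And>r g. r \<in> schreier_generators \<Longrightarrow> P g \<Longrightarrow> P (r \<circ> g)"
  shows "P g"
proof -
  obtain ws where ws: "set ws \<subseteq> S" "act \<sigma> ws 0 = 0" "g = act h ws"
    using g unfolding stab_def by blast
  have "P (act h (rev (path_word (act \<sigma> ws 0)) @ ws))" by (rule stab_induct[OF ws(1) P1 P2])
  then show ?thesis using ws(2,3) by simp
qed

text \<open>
  Right cosets of the stabiliser correspond to the images of \<open>0\<close> under the inverses of their
  elements, hence the reversed word.
\<close>

definition coset_at :: "nat \<Rightarrow> ('b \<Rightarrow> 'b) set" where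
  "coset_at i = {act h ws | ws. set ws \<subseteq> S \<and> act \<sigma> (rev ws) 0 = i}"

lemma stab_coset:
  assumes us: "set us \<subseteq> S"
  shows "(\<lambda>k. k \<circ> act h us) ` stab = coset_at (act \<sigma> (rev us) 0)"
proof (intro equalityI subsetI)
  fix g assume "g \<in> (\<lambda>k. k \<circ> act h us) ` stab"
  then obtain ks where ks: "set ks \<subseteq> S" "act \<sigma> ks 0 = 0" "g = act h (ks @ us)"
    unfolding stab_def by auto
  have "act \<sigma> (rev ks) 0 = 0" using \<sigma>_cancel(1)[of ks 0] ks(2) by simp
  then have "act \<sigma> (rev (ks @ us)) 0 = act \<sigma> (rev us) 0" by simp
  moreover have "set (ks @ us) \<subseteq> S" using ks(1) us by simp
  ultimately show "g \<in> coset_at (act \<sigma> (rev us) 0)" unfolding coset_at_def using ks(3) by blast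
next
  fix g assume "g \<in> coset_at (act \<sigma> (rev us) 0)"
  then obtain ws where ws: "set ws \<subseteq> S" "act \<sigma> (rev ws) 0 = act \<sigma> (rev us) 0" "g = act h ws"
    unfolding coset_at_def by blast
  have "act \<sigma> (ws @ rev us) 0 = 0" using \<sigma>_cancel(2)[of ws 0] ws(2) by simp
  moreover have "set (ws @ rev us) \<subseteq> S" using ws(1) us by simp
  ultimately have "act h (ws @ rev us) \<in> stab" unfolding stab_def by blast
  moreover have "g = act h (ws @ rev us) \<circ> act h us"
    using ws(3) h_cancel(1)[OF us] by (simp add: fun_eq_iff)
  ultimately show "g \<in> (\<lambda>k. k \<circ> act h us) ` stab" by blast
qed

lemma inj_on_coset_at: "inj_on coset_at {..<I}"
proof (rule inj_onI)
  fix i j assume i: "i \<in> {..<I}" and eq: "coset_at i = coset_at j"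
  have mem: "act h (rev (path_word i)) \<in> coset_at i"
    unfolding coset_at_def
  proof (intro CollectI exI conjI)
    show "set (rev (path_word i)) \<subseteq> S" using set_path_word by simp
    show "act \<sigma> (rev (rev (path_word i))) 0 = i" using i act_path_word by simp
  qed (rule refl)
  have "act h (rev (path_word i)) \<in> coset_at j" using mem by (simp only: eq)
  then obtain ws where ws: "set ws \<subseteq> S" "act \<sigma> (rev ws) 0 = j" "act h (rev (path_word i)) = act h ws"
    unfolding coset_at_def by blast
  have eq': "act \<sigma> (rev (rev (path_word i))) = act \<sigma> (rev ws)"
    using ws set_path_word by (intro well_defined_rev) auto
  have "i = act \<sigma> (rev (rev (path_word i))) 0" using i act_path_word by simp
  also have "\<dots> = j" using ws(2) by (simp only: eq')
  finally show "i = j" .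
qed

lemma card_cosets: "card ((\<lambda>us. (\<lambda>k. k \<circ> act h us) ` stab) ` {us. set us \<subseteq> S}) = I"
proof -
  have "(\<lambda>us. (\<lambda>k. k \<circ> act h us) ` stab) ` {us. set us \<subseteq> S}
      = (\<lambda>us. coset_at (act \<sigma> (rev us) 0)) ` {us. set us \<subseteq> S}"
    by (rule image_cong[OF refl]) (simp add: stab_coset)
  also have "\<dots> = coset_at ` (\<lambda>us. act \<sigma> (rev us) 0) ` {us. set us \<subseteq> S}"
    by (simp only: image_image)
  also have "(\<lambda>us. act \<sigma> (rev us) 0) ` {us. set us \<subseteq> S} = {..<I}"
  proof (intro equalityI subsetI)
    fix i assume "i \<in> {..<I}"
    then have "i = act \<sigma> (rev (rev (path_word i))) 0" using act_path_word by simp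
    moreover have "rev (path_word i) \<in> {us. set us \<subseteq> S}" using set_path_word by simp
    ultimately show "i \<in> (\<lambda>us. act \<sigma> (rev us) 0) ` {us. set us \<subseteq> S}" by (rule image_eqI)
  next
    fix i assume "i \<in> (\<lambda>us. act \<sigma> (rev us) 0) ` {us. set us \<subseteq> S}"
    then show "i \<in> {..<I}" using act_\<sigma>_less I_pos by auto
  qed
  finally show ?thesis by (simp only: card_image[OF inj_on_coset_at] card_lessThan)
qed

end

section \<open>Groups generated by reflections\<close>

lemma hrefl_involution:
  assumes "lor e e = 1" shows "hrefl e (hrefl e x) = x"
  by (simp add: Rep_hyp_inject[symmetric] Rep_hrefl[OF assms] lor_algebra assms)

text \<open>
  The conjugate is the reflection in the reflected normal vector.
\<close>

lemma is_reflection_conjugate: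
  assumes r: "is_reflection r" and f: "lor f f = 1"
  shows "is_reflection (hrefl f \<circ> r \<circ> hrefl f)"
proof -
  obtain e where e: "lor e e = 1" "r = hrefl e" using r by (auto simp: is_reflection_def)
  define g where "g = e - (2 * lor e f) *\<^sub>R f"
  have fe: "lor f e = lor e f" by (rule lor_commute)
  have gg: "lor g g = 1" by (simp add: g_def lor_algebra e f fe)
  have "(hrefl f \<circ> r \<circ> hrefl f) x = hrefl g x" for x
    by (simp add: Rep_hyp_inject[symmetric] Rep_hrefl[OF f] Rep_hrefl[OF e(1)] Rep_hrefl[OF gg] e(2))
      (simp add: g_def lor_algebra e f fe algebra_simps)
  then have "hrefl f \<circ> r \<circ> hrefl f = hrefl g" by blast
  then show ?thesis using gg unfolding is_reflection_def by blast
qed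

lemma is_reflection_act_conjugate:
  assumes "is_reflection r" "\<And>f. f \<in> set us \<Longrightarrow> lor f f = 1"
  shows "is_reflection (act hrefl (rev us) \<circ> r \<circ> act hrefl us)"
  using assms
proof (induction us arbitrary: r)
  case (Cons u us)
  have "is_reflection (act hrefl (rev us) \<circ> (hrefl u \<circ> r \<circ> hrefl u) \<circ> act hrefl us)"
    using Cons.prems by (intro Cons.IH is_reflection_conjugate) auto
  then show ?case by (simp add: comp_def)
qed simp

lemma generate_hrefl:
  assumes N: "\<And>e. e \<in> N \<Longrightarrow> lor e e = 1"
  shows "generate isometry_group (hrefl ` N) = {act hrefl ws | ws. set ws \<subseteq> N}"
proof (intro equalityI subsetI)
  interpret G: group isometry_group by (rule group_isometry_group)
  fix g assume "g \<in> generate isometry_group (hrefl ` N)"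
  then show "g \<in> {act hrefl ws | ws. set ws \<subseteq> N}"
  proof (induction rule: generate.induct)
    case one
    then show ?case by (auto simp: isometry_group_def intro!: exI[of _ "[]"])
  next
    case (incl g)
    then obtain e where "e \<in> N" "g = act hrefl [e]" by auto
    then show ?case by (auto intro!: exI[of _ "[e]"])
  next
    case (inv g)
    then obtain e where e: "e \<in> N" "g = hrefl e" by auto
    have "g \<otimes>\<^bsub>isometry_group\<^esub> g = \<one>\<^bsub>isometry_group\<^esub>"
      using hrefl_involution[OF N[OF e(1)]] e(2) by (simp add: isometry_group_def fun_eq_iff)
    then have "inv\<^bsub>isometry_group\<^esub> g = g"
      using hrefl_in_isometry_group[OF N[OF e(1)]] e(2) by (intro G.inv_equality) auto
    then show ?case using e by (auto intro!: exI[of _ "[e]"])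
  next
    case (eng g1 g2)
    then obtain us vs where "set us \<subseteq> N" "set vs \<subseteq> N" "g1 = act hrefl us" "g2 = act hrefl vs" by blast
    then show ?case by (auto simp: isometry_group_def intro!: exI[of _ "us @ vs"])
  qed
next
  fix g assume "g \<in> {act hrefl ws | ws. set ws \<subseteq> N}"
  then obtain ws where "set ws \<subseteq> N" "g = act hrefl ws" by blast
  then show "g \<in> generate isometry_group (hrefl ` N)"
  proof (induction ws arbitrary: g)
    case Nil
    then show ?case using generate.one[of isometry_group "hrefl ` N"] by (simp add: isometry_group_def id_def)
  next
    case (Cons w ws)
    then have "hrefl w \<otimes>\<^bsub>isometry_group\<^esub> act hrefl ws \<in> generate isometry_group (hrefl ` N)"
      by (intro generate.eng[OF generate.incl]) auto
    then show ?case using Cons.prems by (simp add: isometry_group_def comp_def)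
  qed
qed

section \<open>Redoublable polyhedra\<close>

lemma cos_pi_over_nonneg:
  assumes "m \<ge> 2" shows "0 \<le> cos (pi / real m)"
proof -
  have "pi / real m \<le> pi / 2" using assms by (intro divide_left_mono) auto
  moreover have "0 \<le> pi / real m" by simp
  ultimately show ?thesis by (intro cos_ge_zero) linarith+
qed

text \<open>
  If at least one of the two maps is trivial, an alternating word of length \<open>m\<close> acts as a power
  of the other one; this power depends on the first letter for odd \<open>m\<close> only.  This is where even
  angles are needed.
\<close>

lemma path_relation:
  fixes \<sigma> :: "'s \<Rightarrow> nat \<Rightarrow> nat"
  assumes "\<sigma> s = id \<and> \<sigma> t = id \<or> even m \<and> (\<sigma> s = id \<or> \<sigma> t = id)"
  shows "act \<sigma> (alt s t m) = act \<sigma> (alt t s m)"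
proof -
  have triv: "act \<sigma> (alt s t m) = id" if "\<sigma> s = id" "\<sigma> t = id" for s t m
    using that by (induction m arbitrary: s t) simp_all
  from assms consider "\<sigma> s = id \<and> \<sigma> t = id" | k where "m = 2 * k" "\<sigma> s = id"
    | k where "m = 2 * k" "\<sigma> t = id" by (auto elim!: evenE)
  then show ?thesis
  proof cases
    case 1 then show ?thesis by (simp add: triv)
  next
    case 2 then show ?thesis by (simp add: act_alt_even_id)
  next
    case 3 then show ?thesis by (simp add: act_alt_even_id)
  qed
qed

lemma act_pair:
  "act (\<lambda>e (x, i). (f e x, g e i)) ws (x, i) = (act f ws x, act g ws i)"
  by (induction ws arbitrary: x i) simp_all

context nonobtuse_polyhedron
begin

text \<open>
  Let the wall reflections act on pairs of a point of hyperbolic space and a natural number, by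
  reflection and by the path.  The half-space condition only looks at the first component, so a
  word that acts trivially on the first component maps the chamber to itself, and Tits's lemma
  shows that the word acts trivially on pairs.
\<close>

theorem path_action_if_even_angles:
  assumes a: "a \<in> normals Q" and b: "b \<in> normals Q" and disj: "Q \<inter> hyperplane a \<inter> hyperplane b = {}"
    and I: "I > 0"
    and angle: "\<And>e f v. e \<in> normals Q \<Longrightarrow> f \<in> normals Q \<Longrightarrow> e \<noteq> f \<Longrightarrow> v \<in> Q \<Longrightarrow>
      lor (Rep_hyp v) e = 0 \<Longrightarrow> lor (Rep_hyp v) f = 0 \<Longrightarrow>
      \<exists>m::nat. m \<ge> 2 \<and> lor e f = - cos (pi / real m) \<and> (e \<in> {a, b} \<or> f \<in> {a, b} \<longrightarrow> even m)"
  defines "\<sigma> \<equiv> \<lambda>s. if s = a then path_step I True else if s = b then path_step I False else id"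
  shows "path_action hrefl (normals Q) \<sigma> a b I"
proof -
  define T where "T = (\<lambda>e (x, i). (hrefl e x, \<sigma> e i))"
  define H where "H e = {y :: 'a hyp \<times> nat. lor (Rep_hyp (fst y)) e < 0}" for e
  have T: "T e (x, i) = (hrefl e x, \<sigma> e i)" for e x i by (simp add: T_def)
  have actT: "act T ws (x, i) = (act hrefl ws x, act \<sigma> ws i)" for ws x i
    unfolding T_def by (rule act_pair)
  have \<sigma>_inv: "\<sigma> e (\<sigma> e i) = i" for e i by (simp add: \<sigma>_def path_step_involution)
  have T_inv: "T e (T e y) = y" if "e \<in> normals Q" for e y
    using hrefl_involution[OF normals_unit[OF that]] \<sigma>_inv by (cases y) (simp add: T)
  have p_a: "\<not> (\<exists>v\<in>Q. lor (Rep_hyp v) a = 0 \<and> lor (Rep_hyp v) b = 0)"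
    using disj by (auto simp: hyperplane_def)
  have ab: "a \<noteq> b" using disj face_nonempty[OF a] by auto
  have pair: "(\<forall>y\<in>H s \<inter> H t. act T us y \<in> H s) \<or>
      (\<forall>y\<in>H s \<inter> H t. T s (act T us y) \<in> H s) \<and>
        wlen T {s, t} (T s \<circ> act T us) < wlen T {s, t} (act T us)"
    if s: "s \<in> normals Q" and t: "t \<in> normals Q" and st: "s \<noteq> t" and us: "set us \<subseteq> {s, t}" for s t us
  proof -
    note unit = normals_unit[OF s] normals_unit[OF t]
    have "\<exists>m::nat. (m = 0 \<and> lor s t \<le> -1 \<or> m \<ge> 2 \<and> lor s t = - cos (pi / real m)) \<and>
        (m > 0 \<longrightarrow> act T (alt s t m) = act T (alt t s m))"
    proof (cases "\<exists>v\<in>Q. lor (Rep_hyp v) s = 0 \<and> lor (Rep_hyp v) t = 0")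
      case True
      then obtain m :: nat where m: "m \<ge> 2" "lor s t = - cos (pi / real m)"
        "s \<in> {a, b} \<or> t \<in> {a, b} \<longrightarrow> even m"
        using angle[OF s t st] by blast
      \<comment> \<open>The two walls that act on the path do not meet, so at most one of \<open>s\<close> and \<open>t\<close> is among them.\<close>
      have "{s, t} \<noteq> {a, b}" using True p_a by (auto simp: doubleton_eq_iff)
      then have "\<sigma> s = id \<and> \<sigma> t = id \<or> even m \<and> (\<sigma> s = id \<or> \<sigma> t = id)"
        using m(3) st by (auto simp: \<sigma>_def)
      then have "act \<sigma> (alt s t m) = act \<sigma> (alt t s m)" by (rule path_relation)
      then have "act T (alt s t m) y = act T (alt t s m) y" for y
        using braid_relation[OF unit m(1,2)] by (cases y) (simp add: actT)
      then have "act T (alt s t m) = act T (alt t s m)" by blast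
      then show ?thesis using m by blast
    next
      case False
      then have "lor s t \<le> -1" by (intro lor_le_minus_1_if_disjoint[OF s t]) blast
      then show ?thesis by (intro exI[of _ 0]) simp
    qed
    then obtain m :: nat where m: "m = 0 \<and> lor s t \<le> -1 \<or> m \<ge> 2 \<and> lor s t = - cos (pi / real m)"
      and rel: "m > 0 \<Longrightarrow> act T (alt s t m) = act T (alt t s m)" by blast
    show ?thesis
    proof (rule dihedral_rank_two[where m = m])
      fix n y assume n: "m = 0 \<or> n < m" and y: "y \<in> H s \<inter> H t"
      obtain x i where xi: "y = (x, i)" by (cases y)
      have "lor (Rep_hyp (act hrefl (alt t s n) x)) s < 0"
        using y by (intro alt_negative[OF unit m n]) (simp_all add: xi H_def)
      then show "act T (alt t s n) y \<in> H s" by (simp add: xi actT H_def)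
    qed (use T_inv s t rel us in blast)+
  qed
  interpret tits_chamber T "normals Q" H
  proof
    fix s y assume "s \<in> normals Q" "y \<in> H s"
    then show "T s y \<notin> H s"
      using normals_unit by (cases y) (simp add: H_def T Rep_hrefl lor_algebra)
  qed (use T_inv pair in blast)+
  show ?thesis
  proof
    fix ws assume ws: "set ws \<subseteq> normals Q" and id: "act hrefl ws = id"
    have "(p, i) \<in> chamber" for i
      using p_strict_normals by (simp add: chamber_def H_def)
    then have "act T ws = id"
      using act_eq_id_if_meets_chamber[OF ws, of "(p, 0)"] by (simp add: actT id)
    then have "act T ws (p, i) = (p, i)" for i by simp
    then show "act \<sigma> ws = id" by (simp add: actT fun_eq_iff)
  next
    fix s x assume "s \<in> normals Q"
    then show "hrefl s (hrefl s x) = x" by (intro hrefl_involution normals_unit)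
  qed (simp_all add: a b ab I \<sigma>_def)
qed

end

theorem corollary4p2:
  fixes Q :: "'a::euclidean_space hyp set" and I :: nat
  assumes "redoublable Q" and "I > 0"
  shows "\<exists>K. subgroup K (coxeter_group Q) \<and>
             card (rcosets\<^bsub>coxeter_group Q\<^esub> K) = I \<and>
             (\<exists>R. (\<forall>r\<in>R. is_reflection r) \<and> K = generate isometry_group R)"
proof -
  have cox: "coxeter_polyhedron Q" using assms(1) by (simp add: redoublable_def)
  obtain F G where F: "doubling_wall Q F" and G: "doubling_wall Q G" and FG: "F \<inter> G = {}"
    using assms(1) by (auto simp: redoublable_def)
  obtain E where E: "\<forall>e\<in>E. lor e e = 1" "Q = (\<Inter>e\<in>E. halfspace e)"
    "\<forall>x. \<exists>r>0. finite {e\<in>E. hyperplane e \<inter> ball x r \<noteq> {}}"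
    using cox by (auto simp: coxeter_polyhedron_def convex_polyhedron_def)
  obtain p where p: "p \<in> interior Q" using cox by (auto simp: coxeter_polyhedron_def)
  interpret polyhedron_with_interior Q E p
  proof
    show "lor e e = 1" if "e \<in> E" for e using E(1) that by blast
    show "Q = (\<Inter>e\<in>E. halfspace e)" by (rule E(2))
    show "\<exists>r>0. finite {e\<in>E. hyperplane e \<inter> ball x r \<noteq> {}}" for x using E(3) by blast
    show "p \<in> interior Q" by (rule p)
  qed
  have lor_angle: "lor e f = - cos (pi / real m)"
    if e: "e \<in> normals Q" and f: "f \<in> normals Q" and v: "lor (Rep_hyp v) e = 0" "lor (Rep_hyp v) f = 0"
      and d: "dihedral_angle Q (Q \<inter> hyperplane e) (Q \<inter> hyperplane f) = pi / real m"
    for e f v and m :: nat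
  proof -
    have "(lor e f)\<^sup>2 \<le> lor e e * lor f f"
      using v by (intro lor_orth_Cauchy_Schwarz[OF lor_Rep_hyp[of v]]) (simp_all only: lor_commute[of _ "Rep_hyp v"])
    \<comment> \<open>The normals of walls with a common point are tangent unit vectors there, so that \<open>arccos\<close> is inverted by \<open>cos\<close>.\<close>
    then have "(lor e f)\<^sup>2 \<le> 1" by (simp add: normals_unit e f)
    then have "\<bar>lor e f\<bar> \<le> 1" by (simp add: abs_square_le_1)
    then have "lor e f = cos (arccos (lor e f))" by (simp add: cos_arccos)
    also have "arccos (lor e f) = pi - pi / real m"
      using d by (simp add: dihedral_angle_def wall_normal_face e f)
    finally show ?thesis by simp
  qed
  interpret nonobtuse_polyhedron Q E p
  proof
    fix v e g assume v: "v \<in> Q" and e: "e \<in> normals Q" and g: "g \<in> adjacent v e" and ve: "lor (Rep_hyp v) e = 0"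
    have g': "g \<in> normals Q" "lor (Rep_hyp v) g = 0"
      "hcodim (Q \<inter> hyperplane e \<inter> (Q \<inter> hyperplane g)) = 2"
      using g by (simp_all add: adjacent_def)
    have "v \<in> Q \<inter> hyperplane e \<inter> (Q \<inter> hyperplane g)" using v ve g'(2) by (simp add: hyperplane_def)
    then have "\<exists>m::nat. m \<ge> 2 \<and> dihedral_angle Q (Q \<inter> hyperplane e) (Q \<inter> hyperplane g) = pi / real m"
      using cox e g'(1,3) wall_iff unfolding coxeter_polyhedron_def by blast
    then obtain m :: nat where m: "m \<ge> 2"
      "dihedral_angle Q (Q \<inter> hyperplane e) (Q \<inter> hyperplane g) = pi / real m" by blast
    then show "lor e g \<le> 0"
      using lor_angle[OF e g'(1) ve g'(2) m(2)] cos_pi_over_nonneg[OF m(1)] by simp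
  qed
  obtain a where a: "a \<in> normals Q" "F = Q \<inter> hyperplane a"
    using F wall_iff by (auto simp: doubling_wall_def)
  obtain b where b: "b \<in> normals Q" "G = Q \<inter> hyperplane b"
    using G wall_iff by (auto simp: doubling_wall_def)
  have face_eq: "e = f" if "e \<in> normals Q" "f \<in> normals Q" "Q \<inter> hyperplane e = Q \<inter> hyperplane f" for e f
    using that wall_normal_face by metis
  have doubling: "\<exists>m::nat. m \<ge> 2 \<and> lor e f = - cos (pi / real m) \<and> even m"
    if D: "doubling_wall Q (Q \<inter> hyperplane e)" and ef: "e \<in> normals Q" "f \<in> normals Q" "e \<noteq> f"
      and v: "v \<in> Q" "lor (Rep_hyp v) e = 0" "lor (Rep_hyp v) f = 0" for e f v
  proof -
    have "v \<in> Q \<inter> hyperplane e \<inter> (Q \<inter> hyperplane f)" using v by (simp add: hyperplane_def)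
    moreover have "Q \<inter> hyperplane f \<noteq> Q \<inter> hyperplane e" using face_eq ef by blast
    moreover have "wall Q (Q \<inter> hyperplane f)" using wall_iff ef by blast
    ultimately obtain m :: nat where "m \<ge> 2" "even m"
      "dihedral_angle Q (Q \<inter> hyperplane e) (Q \<inter> hyperplane f) = pi / real m"
      using D unfolding doubling_wall_def by blast
    then show ?thesis using lor_angle[OF ef(1,2) v(2,3)] by blast
  qed
  define \<sigma> where "\<sigma> = (\<lambda>s. if s = a then path_step I True else if s = b then path_step I False else id)"
  interpret path_action hrefl "normals Q" \<sigma> a b I
    unfolding \<sigma>_def
  proof (rule path_action_if_even_angles[OF a(1) b(1) _ assms(2)])
    show "Q \<inter> hyperplane a \<inter> hyperplane b = {}" using FG a(2) b(2) by blast
    fix e f v assume ef: "e \<in> normals Q" "f \<in> normals Q" "e \<noteq> f"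
      and v: "v \<in> Q" "lor (Rep_hyp v) e = 0" "lor (Rep_hyp v) f = 0"
    consider "e \<in> {a, b}" | "f \<in> {a, b}" | "e \<notin> {a, b}" "f \<notin> {a, b}" by blast
    then show "\<exists>m::nat. m \<ge> 2 \<and> lor e f = - cos (pi / real m) \<and> (e \<in> {a, b} \<or> f \<in> {a, b} \<longrightarrow> even m)"
    proof cases
      case 1
      then have "doubling_wall Q (Q \<inter> hyperplane e)" using F G a b by blast
      from doubling[OF this ef v] show ?thesis by blast
    next
      case 2
      then have "doubling_wall Q (Q \<inter> hyperplane f)" using F G a b by blast
      from doubling[OF this ef(2,1) ef(3)[symmetric] v(1,3,2)] show ?thesis
        by (simp only: lor_commute[of f e]) blast
    next
      case 3
      have "hcodim (Q \<inter> hyperplane e \<inter> (Q \<inter> hyperplane f)) = 2"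
        using meeting_walls_adjacent[OF v(1) ef(1) v(2) ef(2) v(3) ef(3)] by (simp add: adjacent_def)
      moreover have "v \<in> Q \<inter> hyperplane e \<inter> (Q \<inter> hyperplane f)" using v by (simp add: hyperplane_def)
      ultimately obtain m :: nat where "m \<ge> 2"
        "dihedral_angle Q (Q \<inter> hyperplane e) (Q \<inter> hyperplane f) = pi / real m"
        using cox ef(1,2) wall_iff unfolding coxeter_polyhedron_def by blast
      then show ?thesis using lor_angle[OF ef(1,2) v(2,3)] 3 by blast
    qed
  qed
  interpret G: group "isometry_group :: ('a hyp \<Rightarrow> 'a hyp) monoid" by (rule group_isometry_group)
  have gens: "{hrefl (wall_normal Q F) | F. wall Q F} = hrefl ` normals Q"
  proof (intro equalityI subsetI)
    fix r assume "r \<in> {hrefl (wall_normal Q F) | F. wall Q F}"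
    then obtain F where "wall Q F" "r = hrefl (wall_normal Q F)" by blast
    then show "r \<in> hrefl ` normals Q" using wall_iff wall_normal_face by auto
  next
    fix r assume "r \<in> hrefl ` normals Q"
    then obtain e where e: "e \<in> normals Q" "r = hrefl e" by blast
    then have "r = hrefl (wall_normal Q (Q \<inter> hyperplane e))" by (simp only: wall_normal_face)
    then show "r \<in> {hrefl (wall_normal Q F) | F. wall Q F}" using wall_iff e(1) by blast
  qed
  have gens_carrier: "hrefl ` normals Q \<subseteq> carrier isometry_group"
    using hrefl_in_isometry_group normals_unit by blast
  have carrier_W: "carrier (coxeter_group Q) = {act hrefl ws | ws. set ws \<subseteq> normals Q}"
    unfolding coxeter_group_def carrier_subgroup_generated gens
    using gens_carrier by (simp add: Int_absorb1 generate_hrefl normals_unit)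
  have mem_W: "act hrefl ws \<in> carrier (coxeter_group Q)" if "set ws \<subseteq> normals Q" for ws
    unfolding carrier_W using that by blast
  have mult_W: "x \<otimes>\<^bsub>coxeter_group Q\<^esub> y = x \<circ> y" for x y
    by (simp add: coxeter_group_def isometry_group_def)
  have one_W: "\<one>\<^bsub>coxeter_group Q\<^esub> = id"
    by (simp add: coxeter_group_def isometry_group_def)
  interpret W: group "coxeter_group Q"
    unfolding coxeter_group_def by (rule G.group_subgroup_generated)
  have sub: "stab \<subseteq> carrier (coxeter_group Q)" unfolding carrier_W stab_def by blast
  have inv_W: "inv\<^bsub>coxeter_group Q\<^esub> (act hrefl ws) = act hrefl (rev ws)" if "set ws \<subseteq> normals Q" for ws
  proof (rule W.inv_equality)
    show "act hrefl (rev ws) \<otimes>\<^bsub>coxeter_group Q\<^esub> act hrefl ws = \<one>\<^bsub>coxeter_group Q\<^esub>"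
      using h_cancel(1)[OF that] by (simp add: mult_W one_W fun_eq_iff)
    show "act hrefl ws \<in> carrier (coxeter_group Q)" by (rule mem_W) (rule that)
    show "act hrefl (rev ws) \<in> carrier (coxeter_group Q)" by (rule mem_W) (simp add: that)
  qed
  have "subgroup stab (coxeter_group Q)"
  proof (rule W.subgroupI)
    have "act hrefl [] \<in> stab" unfolding stab_def by (intro CollectI exI[of _ "[]"]) simp
    then show "stab \<noteq> {}" by blast
    fix x assume "x \<in> stab"
    then obtain ws where ws: "set ws \<subseteq> normals Q" "act \<sigma> ws 0 = 0" "x = act hrefl ws"
      unfolding stab_def by blast
    have "act \<sigma> (rev ws) 0 = 0" using \<sigma>_cancel(1)[of ws 0] ws(2) by simp
    then show "inv\<^bsub>coxeter_group Q\<^esub> x \<in> stab"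
      unfolding ws(3) inv_W[OF ws(1)] stab_def using ws(1)
      by (intro CollectI exI[of _ "rev ws"]) simp
    fix y assume "y \<in> stab"
    then obtain vs where vs: "set vs \<subseteq> normals Q" "act \<sigma> vs 0 = 0" "y = act hrefl vs"
      unfolding stab_def by blast
    show "x \<otimes>\<^bsub>coxeter_group Q\<^esub> y \<in> stab"
      unfolding mult_W stab_def using ws vs
      by (intro CollectI exI[of _ "ws @ vs"]) simp
  qed (rule sub)
  moreover have "card (rcosets\<^bsub>coxeter_group Q\<^esub> stab) = I"
  proof -
    have "carrier (coxeter_group Q) = act hrefl ` {us. set us \<subseteq> normals Q}"
      unfolding carrier_W by blast
    moreover have "stab #>\<^bsub>coxeter_group Q\<^esub> g = (\<lambda>k. k \<circ> g) ` stab" for g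
      unfolding r_coset_def mult_W by blast
    moreover have "rcosets\<^bsub>coxeter_group Q\<^esub> stab
        = (\<lambda>g. stab #>\<^bsub>coxeter_group Q\<^esub> g) ` carrier (coxeter_group Q)"
      unfolding RCOSETS_def by blast
    ultimately have "rcosets\<^bsub>coxeter_group Q\<^esub> stab
        = (\<lambda>us. (\<lambda>k. k \<circ> act hrefl us) ` stab) ` {us. set us \<subseteq> normals Q}"
      by (simp only: image_image)
    then show ?thesis using card_cosets by (simp only:)
  qed
  moreover have "stab = generate isometry_group schreier_generators"
  proof (intro equalityI subsetI)
    fix g assume "g \<in> stab"
    then show "g \<in> generate isometry_group schreier_generators"
    proof (rule stab_schreier_induct)
      show "id \<in> generate isometry_group schreier_generators"
        using generate.one[of isometry_group schreier_generators] by (simp add: isometry_group_def id_def)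
      fix r g assume "r \<in> schreier_generators" "g \<in> generate isometry_group schreier_generators"
      then have "r \<otimes>\<^bsub>isometry_group\<^esub> g \<in> generate isometry_group schreier_generators"
        by (intro generate.eng[OF generate.incl])
      then show "r \<circ> g \<in> generate isometry_group schreier_generators" by (simp add: isometry_group_def)
    qed
  next
    have "subgroup stab isometry_group"
      using \<open>subgroup stab (coxeter_group Q)\<close>
      by (simp only: coxeter_group_def G.subgroup_subgroup_generated_iff)
    moreover have "schreier_generators \<subseteq> stab" unfolding schreier_generators_def by blast
    ultimately have "generate isometry_group schreier_generators \<subseteq> stab"
      by (intro G.generate_subgroup_incl)
    then show "g \<in> stab" if "g \<in> generate isometry_group schreier_generators" for g
      using that by blast
  qed
  moreover have "\<forall>r\<in>schreier_generators. is_reflection r"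
  proof
    fix r assume "r \<in> schreier_generators"
    then obtain us s where us: "set us \<subseteq> normals Q" "s \<in> normals Q" "r = act hrefl (rev us @ s # us)"
      unfolding schreier_generators_def by blast
    have "is_reflection (hrefl s)" unfolding is_reflection_def using normals_unit[OF us(2)] by blast
    moreover have "lor f f = 1" if "f \<in> set us" for f using that us(1) normals_unit by blast
    ultimately have "is_reflection (act hrefl (rev us) \<circ> hrefl s \<circ> act hrefl us)"
      by (rule is_reflection_act_conjugate)
    then show "is_reflection r" using us(3) by (simp add: comp_def)
  qed
  ultimately show ?thesis by blast
qed

end
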